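(* Let $\mathfrak{A}$ be a unital $C^{\ast}$-algebra and let $\delta\colon\mathcal{D}(\delta)\to\mathfrak{A}$ be a $\ast$-derivation. If $\delta$ is well behaved, then $\delta$ is well behaved in the matricial sense; that is, for every $n=1,2,\dots$ the $\ast$-derivation $\delta_n=\delta\otimes\mathrm{id}_n\colon\mathcal{D}(\delta)\otimes M_n\to\mathfrak{A}\otimes M_n$ is well behaved.
   Context: Let $\mathfrak{A}$ be a unital $C^{\ast}$-algebra with unit $1$. A (possibly unbounded) $\ast$-derivation is a linear map $\delta\colon\mathcal{D}(\delta)\to\mathfrak{A}$ whose domain $\mathcal{D}(\delta)$ is a dense $\ast$-subalgebra of $\mathfrak{A}$ containing $1$, and such that $\delta(ab)=\delta(a)b+a\delta(b)$ for $a,b\in\mathcal{D}(\delta)$ and $\delta(a^{\ast})=\delta(a)^{\ast}$ for $a\in\mathcal{D}(\delta)$. A $\ast$-derivation $\delta\colon\mathcal{D}(\delta)\to\mathfrak{A}$ is well behaved if for every positive $a\in\mathcal{D}(\delta)$ there is a state $\phi$ on $\mathfrak{A}$ such that $\phi(a)=\|a\|$ and $\phi(\delta(a))=0$. $M_n$ denotes the complex $n\times n$ matrices; $\mathfrak{A}\otimes M_n$ is identified with the $C^{\ast}$-algebra of $n\times n$ matrices over $\mathfrak{A}$, $\mathcal{D}(\delta)\otimes M_n$ with the matrices having all entries in $\mathcal{D}(\delta)$, and $\delta_n((a_{ij}))=(\delta(a_{ij}))$. *)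

theory Defs
  imports "HOL-Analysis.Analysis"
begin

section \<open>Unital *-algebras and unital C*-algebras\<close>

class unital_star_algebra = ring_1 +
  fixes scaleC :: "complex \<Rightarrow> 'a \<Rightarrow> 'a"
    and star :: "'a \<Rightarrow> 'a"
  assumes scaleC_add_right: "scaleC c (a + b) = scaleC c a + scaleC c b"
    and scaleC_add_left: "scaleC (c + d) a = scaleC c a + scaleC d a"
    and scaleC_scaleC: "scaleC c (scaleC d a) = scaleC (c * d) a"
    and scaleC_one: "scaleC 1 a = a"
    and mult_scaleC_left: "scaleC c a * b = scaleC c (a * b)"
    and mult_scaleC_right: "a * scaleC c b = scaleC c (a * b)"
    and star_add: "star (a + b) = star a + star b"
    and star_scaleC: "star (scaleC c a) = scaleC (cnj c) (star a)"
    and star_mult: "star (a * b) = star b * star a"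
    and star_star: "star (star a) = a"

text \<open>Submultiplicativity of the norm and completeness come from the library classes; the axiom
  \<open>0 \<noteq> 1\<close> of \<open>ring_1\<close> only excludes the zero algebra, which has no states.\<close>

class unital_cstar_algebra = unital_star_algebra + real_normed_algebra_1 + banach +
  assumes scaleR_scaleC: "scaleR r a = scaleC (complex_of_real r) a"
    and norm_scaleC: "norm (scaleC c a) = cmod c * norm a"
    and cstar_identity: "norm (star a * a) = (norm a)\<^sup>2"


section \<open>Positive elements, states, well behaved *-derivations\<close>

definition positive_elt :: "'a::unital_star_algebra \<Rightarrow> bool" where
  "positive_elt a \<longleftrightarrow> (\<exists>b. a = star b * b)"

definition state :: "('a::unital_star_algebra \<Rightarrow> complex) \<Rightarrow> bool" where
  "state \<phi> \<longleftrightarrow>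
     (\<forall>a b. \<phi> (a + b) = \<phi> a + \<phi> b) \<and>
     (\<forall>c a. \<phi> (scaleC c a) = c * \<phi> a) \<and>
     (\<forall>a. positive_elt a \<longrightarrow> \<phi> a \<in> \<real>\<^sub>\<ge>\<^sub>0) \<and>
     \<phi> 1 = 1"

definition unital_star_subalgebra :: "'a::unital_star_algebra set \<Rightarrow> bool" where
  "unital_star_subalgebra D \<longleftrightarrow>
     1 \<in> D \<and>
     (\<forall>a\<in>D. \<forall>b\<in>D. a + b \<in> D) \<and>
     (\<forall>c. \<forall>a\<in>D. scaleC c a \<in> D) \<and>
     (\<forall>a\<in>D. \<forall>b\<in>D. a * b \<in> D) \<and>
     (\<forall>a\<in>D. star a \<in> D)"

text \<open>The norm is an explicit argument \<open>N\<close> of the following definitions, so that they apply both to a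
  C*-algebra with its norm and to the *-algebra of matrices over it with the norm
  \<open>operator_norm\<close> defined further down.\<close>

definition norm_dense :: "('a::unital_star_algebra \<Rightarrow> real) \<Rightarrow> 'a set \<Rightarrow> bool" where
  "norm_dense N D \<longleftrightarrow> (\<forall>a. \<forall>\<epsilon>>0. \<exists>d\<in>D. N (a - d) < \<epsilon>)"

text \<open>A partially defined map is given by its domain \<open>D\<close> and a total function \<open>\<delta>\<close> whose values
  outside \<open>D\<close> are irrelevant.\<close>

definition star_derivation :: "('a::unital_star_algebra \<Rightarrow> real) \<Rightarrow> 'a set \<Rightarrow> ('a \<Rightarrow> 'a) \<Rightarrow> bool" where
  "star_derivation N D \<delta> \<longleftrightarrow>
     unital_star_subalgebra D \<and> norm_dense N D \<and>
     (\<forall>a\<in>D. \<forall>b\<in>D. \<delta> (a + b) = \<delta> a + \<delta> b) \<and>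
     (\<forall>c. \<forall>a\<in>D. \<delta> (scaleC c a) = scaleC c (\<delta> a)) \<and>
     (\<forall>a\<in>D. \<forall>b\<in>D. \<delta> (a * b) = \<delta> a * b + a * \<delta> b) \<and>
     (\<forall>a\<in>D. \<delta> (star a) = star (\<delta> a))"

definition well_behaved :: "('a::unital_star_algebra \<Rightarrow> real) \<Rightarrow> 'a set \<Rightarrow> ('a \<Rightarrow> 'a) \<Rightarrow> bool" where
  "well_behaved N D \<delta> \<longleftrightarrow>
     (\<forall>a\<in>D. positive_elt a \<longrightarrow>
        (\<exists>\<phi>. state \<phi> \<and> \<phi> a = complex_of_real (N a) \<and> \<phi> (\<delta> a) = 0))"


section \<open>Square matrices over a *-algebra\<close>

text \<open>A copy of the type of square matrices is needed because on \<open>'a ^ 'n ^ 'n\<close> itself the library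
  already fixes the componentwise product.\<close>

typedef ('a, 'n) sqmat = "UNIV :: ('a ^ 'n ^ 'n::finite) set"
  morphisms mat_of Sqmat ..

setup_lifting type_definition_sqmat

instantiation sqmat :: (unital_star_algebra, finite) unital_star_algebra
begin

lift_definition zero_sqmat :: "('a, 'b) sqmat" is 0 .
lift_definition one_sqmat :: "('a, 'b) sqmat" is "mat 1" .
lift_definition plus_sqmat :: "('a, 'b) sqmat \<Rightarrow> ('a, 'b) sqmat \<Rightarrow> ('a, 'b) sqmat" is "(+)" .
lift_definition minus_sqmat :: "('a, 'b) sqmat \<Rightarrow> ('a, 'b) sqmat \<Rightarrow> ('a, 'b) sqmat" is "(-)" .
lift_definition uminus_sqmat :: "('a, 'b) sqmat \<Rightarrow> ('a, 'b) sqmat" is uminus .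
lift_definition times_sqmat :: "('a, 'b) sqmat \<Rightarrow> ('a, 'b) sqmat \<Rightarrow> ('a, 'b) sqmat" is "(**)" .
lift_definition scaleC_sqmat :: "complex \<Rightarrow> ('a, 'b) sqmat \<Rightarrow> ('a, 'b) sqmat"
  is "\<lambda>c A. \<chi> i j. scaleC c (A $ i $ j)" .
lift_definition star_sqmat :: "('a, 'b) sqmat \<Rightarrow> ('a, 'b) sqmat"
  is "\<lambda>A. \<chi> i j. star (A $ j $ i)" .

instance
proof
  have scaleC_zero: "scaleC c (0::'a) = 0" for c
    using scaleC_add_right[of c "0::'a" 0] by simp
  have scaleC_sum: "scaleC c (sum f S) = (\<Sum>k\<in>S. scaleC c (f k))"
    for c and f :: "'b \<Rightarrow> 'a" and S
    by (induction S rule: infinite_finite_induct) (simp_all add: scaleC_zero scaleC_add_right)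
  have star_zero: "star (0::'a) = 0"
    using star_add[of "0::'a" 0] by simp
  have star_sum: "star (sum f S) = (\<Sum>k\<in>S. star (f k))" for f :: "'b \<Rightarrow> 'a" and S
    by (induction S rule: infinite_finite_induct) (simp_all add: star_zero star_add)
  fix A B C :: "('a, 'b) sqmat" and c d :: complex
  show "A + B + C = A + (B + C)" by transfer (simp add: add.assoc)
  show "A + B = B + A" by transfer (simp add: add.commute)
  show "0 + A = A" by transfer simp
  show "- A + A = 0" by transfer simp
  show "A - B = A + - B" by transfer simp
  show "A * B * C = A * (B * C)" by transfer (simp add: matrix_mul_assoc)
  show "1 * A = A" by transfer simp
  show "A * 1 = A" by transfer simp
  show "(A + B) * C = A * C + B * C"
    by transfer (simp add: matrix_matrix_mult_def vec_eq_iff distrib_right sum.distrib)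
  show "A * (B + C) = A * B + A * C"
    by transfer (simp add: matrix_matrix_mult_def vec_eq_iff distrib_left sum.distrib)
  show "(0::('a, 'b) sqmat) \<noteq> 1"
    by transfer (simp add: mat_def vec_eq_iff)
  show "scaleC c (A + B) = scaleC c A + scaleC c B"
    by transfer (simp add: vec_eq_iff scaleC_add_right)
  show "scaleC (c + d) A = scaleC c A + scaleC d A"
    by transfer (simp add: vec_eq_iff scaleC_add_left)
  show "scaleC c (scaleC d A) = scaleC (c * d) A"
    by transfer (simp add: vec_eq_iff scaleC_scaleC)
  show "scaleC 1 A = A"
    by transfer (simp add: vec_eq_iff scaleC_one)
  show "scaleC c A * B = scaleC c (A * B)"
    by transfer (simp add: matrix_matrix_mult_def vec_eq_iff scaleC_sum mult_scaleC_left)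
  show "A * scaleC c B = scaleC c (A * B)"
    by transfer (simp add: matrix_matrix_mult_def vec_eq_iff scaleC_sum mult_scaleC_right)
  show "star (A + B) = star A + star B"
    by transfer (simp add: vec_eq_iff star_add)
  show "star (scaleC c A) = scaleC (cnj c) (star A)"
    by transfer (simp add: vec_eq_iff star_scaleC)
  show "star (A * B) = star B * star A"
    by transfer (simp add: matrix_matrix_mult_def vec_eq_iff star_sum star_mult)
  show "star (star A) = A"
    by transfer (simp add: vec_eq_iff star_star)
qed

end

text \<open>The C*-norm of a matrix is its operator norm on the Hilbert module of columns, with inner
  product \<open>\<langle>x, y\<rangle> = \<Sum>i. star (x\<^sub>i) * y\<^sub>i\<close>. It is the unique C*-norm on the *-algebra of
  matrices.\<close>

definition column_norm :: "'a::unital_cstar_algebra ^ 'n \<Rightarrow> real" where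
  "column_norm x = sqrt (norm (\<Sum>i\<in>UNIV. star (x $ i) * x $ i))"

definition operator_norm :: "('a::unital_cstar_algebra, 'n::finite) sqmat \<Rightarrow> real" where
  "operator_norm A = (SUP x \<in> {x. column_norm x \<le> 1}. column_norm (mat_of A *v x))"

definition matrices_over :: "'a set \<Rightarrow> ('a, 'n::finite) sqmat set" where
  "matrices_over D = {A. \<forall>i j. mat_of A $ i $ j \<in> D}"

definition entrywise :: "('a \<Rightarrow> 'a) \<Rightarrow> ('a, 'n::finite) sqmat \<Rightarrow> ('a, 'n) sqmat" where
  "entrywise \<delta> A = Sqmat (\<chi> i j. \<delta> (mat_of A $ i $ j))"

end

theory Submission
  imports Defs
begin

text \<open>Let \<open>A\<close> be a positive matrix over the domain, scaled to a matrix \<open>H\<close> of norm \<open>q < 1\<close>. For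
  \<open>f t = 1 / (1 - t)\<close> the derivation acts by \<open>\<delta> (f H) = f H * \<delta> H * f H\<close>. If \<open>\<phi>\<close> is a state that attains
  the norm of the trace of \<open>f H\<close> (plus a large scalar) and annihilates its derivative, then
  \<open>X \<mapsto> \<phi> (tr (f H * X * f H))\<close> is a positive functional that annihilates \<open>\<delta> H\<close>. As \<open>q\<close> tends to 1
  its normalisation concentrates where \<open>H\<close> is close to its norm, so a weak* limit point is the
  required state. Since \<open>f H\<close> need not have entries in the domain, it is replaced by the partial sums
  \<open>R\<close> of the geometric series, for which the formula for \<open>\<delta> (f H)\<close> holds up to small errors.
  No Hahn-Banach argument is needed: a dense domain and well-behavedness supply enough states.\<close>

section \<open>Elementary facts on *-algebras\<close>

text \<open>Why the resolvent: its derivative carries the same factor on both sides of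
  \<open>\<delta> H\<close>, so a positive functional in the middle factor arises although
  \<open>mtrace\<close> is algebra-valued and in general not cyclic.

  Why it concentrates: let t and s be the values of the trace functional at \<open>R\<close> and
  \<open>R * R\<close>, and n the matrix size. The normalised functional is at least 1 - t/s at
  \<open>H\<close>, and Cauchy-Schwarz gives t^2 <= n s, so t/s <= n/t and only a lower bound for t
  is wanted. Here the maximality of \<open>\<phi>\<close> enters: t dominates the value of every
  other state, and a suitable one yields n^4 t >= sum of q^k for k <= m. The power of n is harmless,
  since that sum approaches 1/(1 - q).

  The other obstacle is the order on matrices: inequalities such as H <= ||H|| 1 are not at hand.
  They are replaced by log-convexity of the moments of a positive element: a log-convex sequence
  bounded by C N^k has ratios at most N, whatever C is. Log-convexity also yields ||A||^k <= ||A^k||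
  for self-adjoint A.\<close>

lemma scaleC_zero_right [simp]: "scaleC c (0::'a::unital_star_algebra) = 0"
  using scaleC_add_right[of c "0::'a" 0] by simp

lemma scaleC_zero_left [simp]: "scaleC 0 (a::'a::unital_star_algebra) = 0"
  using scaleC_add_left[of 0 0 a] by simp

lemma scaleC_minus_one: "scaleC (- 1) (a::'a::unital_star_algebra) = - a"
  using scaleC_add_left[of 1 "- 1" a] by (simp add: scaleC_one eq_neg_iff_add_eq_0 add.commute)

lemma scaleC_sum: "scaleC c (sum f S) = (\<Sum>k\<in>S. scaleC c (f k :: 'a::unital_star_algebra))"
  by (induction S rule: infinite_finite_induct) (simp_all add: scaleC_add_right)

lemma star_zero [simp]: "star (0::'a::unital_star_algebra) = 0"
  using star_add[of "0::'a" 0] by simp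

lemma star_one [simp]: "star (1::'a::unital_star_algebra) = 1"
  by (metis mult_1 mult_1_right star_mult star_star)

lemma star_minus: "star (- a) = - star (a::'a::unital_star_algebra)"
  by (metis add.right_inverse add_eq_0_iff star_add star_zero)

lemma star_power: "star (a ^ k) = star (a::'a::unital_star_algebra) ^ k"
  by (induction k) (simp_all add: star_mult power_commutes)

lemma star_sum: "star (sum f S) = (\<Sum>k\<in>S. star (f k :: 'a::unital_star_algebra))"
  by (induction S rule: infinite_finite_induct) (simp_all add: star_add)

lemma norm_star [simp]: "norm (star a) = norm (a::'a::unital_cstar_algebra)"
proof -
  have le: "norm b \<le> norm (star b)" for b :: 'a
  proof (cases "b = 0")
    case False
    have "(norm b)\<^sup>2 \<le> norm (star b) * norm b"
      using norm_mult_ineq[of "star b" b] by (simp add: cstar_identity)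
    then show ?thesis using False by (simp add: power2_eq_square)
  qed simp
  show ?thesis using le[of a] le[of "star a"] by (simp add: star_star)
qed

lemma star_scaleR: "star (scaleR r a) = scaleR r (star (a::'a::unital_cstar_algebra))"
  by (simp add: scaleR_scaleC star_scaleC)

lemma bounded_linear_star: "bounded_linear (star :: 'a::unital_cstar_algebra \<Rightarrow> 'a)"
  by (rule bounded_linear_intro[where K = 1]) (simp_all add: star_add star_scaleR)

section \<open>Square roots by the binomial series\<close>

lemma abs_gbinomial_half_le_1: "\<bar>(1/2::real) gchoose n\<bar> \<le> 1"
proof (induction n)
  case (Suc n)
  have "of_nat (Suc n) * ((1/2::real) gchoose Suc n) = (1/2 - of_nat n) * ((1/2) gchoose n)"
    using gbinomial_mult_1[of "1/2::real" n] by (simp add: algebra_simps)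
  then have "(1/2::real) gchoose Suc n = (1/2 - real n) / real (Suc n) * ((1/2) gchoose n)"
    by (simp add: field_simps)
  moreover have "\<bar>(1/2 - real n) / real (Suc n)\<bar> \<le> 1"
    by (simp add: field_simps abs_if)
  ultimately show ?case
    using Suc by (simp only: abs_mult mult_le_one abs_ge_zero)
qed simp

text \<open>The binomial series for the square root of 1 - y converges absolutely when y has norm
  below 1, and its real coefficients make the sum self-adjoint.\<close>

lemma positive_elt_one_minus:
  fixes y :: "'a::unital_cstar_algebra"
  assumes "star y = y" and y: "norm y < 1"
  shows "positive_elt (1 - y)"
proof -
  define c where "c n = (- 1) ^ n * ((1/2::real) gchoose n)" for n
  define s where "s = (\<Sum>n. c n *\<^sub>R y ^ n)"
  have c_le: "norm (c n *\<^sub>R y ^ n) \<le> norm y ^ n" for n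
  proof -
    have "norm (c n *\<^sub>R y ^ n) = \<bar>c n\<bar> * norm (y ^ n)" by simp
    also have "\<dots> \<le> 1 * norm y ^ n"
      by (rule mult_mono) (auto simp: c_def abs_mult abs_gbinomial_half_le_1 norm_power_ineq)
    finally show ?thesis by simp
  qed
  have geom: "summable (\<lambda>n. norm y ^ n)"
    using y by (simp add: summable_geometric)
  have summ: "summable (\<lambda>n. norm (c n *\<^sub>R y ^ n))"
    by (rule summable_comparison_test[OF _ geom]) (use c_le in auto)
  \<comment> \<open>Vandermonde convolution: the square of the series has the coefficients of (1 -
    y)^1, which vanish from k = 2 on.\<close>
  have conv: "(\<Sum>i\<le>k. c i * c (k - i)) = (- 1) ^ k * real (1 choose k)" for k
  proof -
    have "(\<Sum>i\<le>k. c i * c (k - i))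
        = (\<Sum>i\<le>k. (- 1) ^ k * (((1/2::real) gchoose i) * ((1/2) gchoose (k - i))))"
      by (rule sum.cong) (auto simp: c_def power_add[symmetric])
    also have "\<dots> = (- 1) ^ k * (1 gchoose k)"
      using gbinomial_Vandermonde[of "1/2::real" "1/2" k]
      by (simp add: sum_distrib_left[symmetric] atLeast0AtMost)
    also have "(1::real) gchoose k = real (1 choose k)"
      using binomial_gbinomial[of 1 k, where ?'a = real] by simp
    finally show ?thesis .
  qed
  have "s * s = (\<Sum>k. \<Sum>i\<le>k. (c i *\<^sub>R y ^ i) * (c (k - i) *\<^sub>R y ^ (k - i)))"
    unfolding s_def by (rule Cauchy_product[OF summ summ])
  also have "\<dots> = (\<Sum>k. (\<Sum>i\<le>k. c i * c (k - i)) *\<^sub>R y ^ k)"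
    by (intro suminf_cong) (simp add: scaleR_sum_left power_add[symmetric] mult.commute)
  also have "\<dots> = (\<Sum>k\<le>1. (\<Sum>i\<le>k. c i * c (k - i)) *\<^sub>R y ^ k)"
    by (rule suminf_finite) (auto simp: conv)
  also have "\<dots> = 1 - y"
    by (simp only: conv) simp
  finally have ss: "s * s = 1 - y" .
  have "star s = (\<Sum>n. star (c n *\<^sub>R y ^ n))"
    unfolding s_def
    by (rule bounded_linear.suminf[OF bounded_linear_star summable_norm_cancel[OF summ]])
  then have "star s = s"
    by (simp add: s_def star_scaleR star_power assms(1))
  with ss show ?thesis unfolding positive_elt_def by metis
qed

lemma positive_elt_minus:
  fixes y :: "'a::unital_cstar_algebra"
  assumes "star y = y" "norm y < r"
  shows "positive_elt (scaleC (of_real r) 1 - y)"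
proof -
  have r: "r > 0" using assms(2) norm_ge_zero[of y] by linarith
  have "positive_elt (1 - (1 / r) *\<^sub>R y)"
    by (rule positive_elt_one_minus) (use assms r in \<open>simp_all add: star_scaleR\<close>)
  then obtain b where b: "1 - (1 / r) *\<^sub>R y = star b * b"
    by (auto simp: positive_elt_def)
  have "star (sqrt r *\<^sub>R b) * (sqrt r *\<^sub>R b) = r *\<^sub>R (star b * b)"
    using r by (simp add: star_scaleR)
  also have "\<dots> = scaleC (of_real r) 1 - y"
    using r by (simp add: b[symmetric] scaleR_diff_right scaleR_scaleC[symmetric])
  finally show ?thesis unfolding positive_elt_def by metis
qed


section \<open>Positive functionals\<close>

text \<open>Traces and sandwiched functionals do not take the value 1 at the unit, so positivity is
  separated from normalisation.\<close>

definition positive_functional :: "('a::unital_star_algebra \<Rightarrow> complex) \<Rightarrow> bool" where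
  "positive_functional \<phi> \<longleftrightarrow>
     (\<forall>a b. \<phi> (a + b) = \<phi> a + \<phi> b) \<and>
     (\<forall>c a. \<phi> (scaleC c a) = c * \<phi> a) \<and>
     (\<forall>a. \<phi> (star a * a) \<in> \<real>\<^sub>\<ge>\<^sub>0)"

lemma state_iff: "state \<phi> \<longleftrightarrow> positive_functional \<phi> \<and> \<phi> 1 = 1"
  by (auto simp: state_def positive_functional_def positive_elt_def)

context
  fixes \<phi> :: "'a::unital_star_algebra \<Rightarrow> complex"
  assumes \<phi>: "positive_functional \<phi>"
begin

lemma pf_add: "\<phi> (a + b) = \<phi> a + \<phi> b"
  using \<phi> by (simp add: positive_functional_def)

lemma pf_scaleC: "\<phi> (scaleC c a) = c * \<phi> a"
  using \<phi> by (simp add: positive_functional_def)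

lemma pf_zero: "\<phi> 0 = 0"
  using pf_scaleC[of 0 0] by simp

lemma pf_minus: "\<phi> (- a) = - \<phi> a"
  using pf_scaleC[of "- 1" a] by (simp add: scaleC_minus_one)

lemma pf_diff: "\<phi> (a - b) = \<phi> a - \<phi> b"
  using pf_add[of a "- b"] by (simp add: pf_minus)

lemma pf_sum: "\<phi> (sum f S) = (\<Sum>k\<in>S. \<phi> (f k))"
  by (induction S rule: infinite_finite_induct) (simp_all add: pf_zero pf_add)

lemma pf_square_real: "\<phi> (star a * a) = complex_of_real (Re (\<phi> (star a * a)))"
  and pf_square_nonneg: "0 \<le> Re (\<phi> (star a * a))"
proof -
  have "\<phi> (star a * a) \<in> \<real>\<^sub>\<ge>\<^sub>0" using \<phi> by (simp add: positive_functional_def)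
  then show "\<phi> (star a * a) = complex_of_real (Re (\<phi> (star a * a)))" "0 \<le> Re (\<phi> (star a * a))"
    by (auto simp: complex_nonneg_Reals_iff complex_eq_iff)
qed

lemma pf_expand:
  "\<phi> (star (a + scaleC c b) * (a + scaleC c b)) =
     \<phi> (star a * a) + c * \<phi> (star a * b) + cnj c * \<phi> (star b * a) + cnj c * c * \<phi> (star b * b)"
  by (simp add: star_add star_scaleC distrib_left distrib_right pf_add mult_scaleC_left
      mult_scaleC_right pf_scaleC scaleC_scaleC algebra_simps)

text \<open>Polarisation: the expansion is real for every c, and c = 1 and c = i determine the
  imaginary and the real part.\<close>

lemma pf_hermitian: "\<phi> (star b * a) = cnj (\<phi> (star a * b))"
proof -
  have "Im (c * \<phi> (star a * b) + cnj c * \<phi> (star b * a)) = 0" for c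
  proof -
    have "Im (\<phi> (star x * x)) = 0" for x
      by (subst pf_square_real) simp
    moreover have "Im (cnj c * c * \<phi> (star b * b)) = 0"
      by (subst pf_square_real) (simp add: mult.commute)
    ultimately show ?thesis
      using arg_cong[OF pf_expand[of a c b], of Im] by simp
  qed
  from this[of 1] this[of \<i>] show ?thesis
    by (simp add: complex_eq_iff)
qed

lemma pf_cauchy_schwarz:
  "(cmod (\<phi> (star a * b)))\<^sup>2 \<le> Re (\<phi> (star a * a)) * Re (\<phi> (star b * b))"
proof -
  define z where "z = \<phi> (star a * b)"
  define p where "p = Re (\<phi> (star a * a))"
  define r where "r = Re (\<phi> (star b * b))"
  have quad: "0 \<le> p - 2 * t * (cmod z)\<^sup>2 + t\<^sup>2 * (cmod z)\<^sup>2 * r" for t :: real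
  proof -
    \<comment> \<open>The factor \<open>cnj z\<close> makes both cross terms real and leaves a
      quadratic in the real parameter \<open>t\<close>.\<close>
    define c where "c = - of_real t * cnj z"
    have "0 \<le> Re (\<phi> (star (a + scaleC c b) * (a + scaleC c b)))"
      by (rule pf_square_nonneg)
    also have "\<dots> = p + Re (c * z) + Re (cnj c * cnj z) + Re (cnj c * c * of_real r)"
      using pf_square_real[of b] by (simp add: pf_expand pf_hermitian[of b a] p_def z_def r_def)
    also have "c * z = of_real (- t * (cmod z)\<^sup>2)"
      unfolding c_def by (simp add: complex_mult_cnj cmod_power2 mult.commute[of "cnj z"] )
    also have "cnj c * cnj z = of_real (- t * (cmod z)\<^sup>2)"
      unfolding c_def by (simp add: complex_mult_cnj cmod_power2)
    also have "cnj c * c = of_real (t\<^sup>2 * (cmod z)\<^sup>2)"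
      unfolding c_def by (simp add: complex_mult_cnj cmod_power2 power2_eq_square[of "complex_of_real t"] mult.commute mult.left_commute)
    finally show ?thesis by simp
  qed
  have "(cmod z)\<^sup>2 \<le> p * r"
  proof (cases "r = 0")
    case True
    have "(cmod z)\<^sup>2 = 0"
    proof (rule ccontr)
      assume nz: "(cmod z)\<^sup>2 \<noteq> 0"
      \<comment> \<open>Without its quadratic term the expression is affine in \<open>t\<close>, and
        this value of \<open>t\<close> makes it -1. For r > 0 the minimiser 1/r is used
        instead.\<close>
      then show False using quad[of "(p + 1) / (2 * (cmod z)\<^sup>2)"] True by simp
    qed
    then show ?thesis using True by simp
  next
    case False
    then have "r > 0" using pf_square_nonneg[of b] by (simp add: r_def)
    then show ?thesis using quad[of "1 / r"] by (simp add: field_simps power2_eq_square)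
  qed
  then show ?thesis by (simp add: z_def p_def r_def)
qed

lemma pf_scale: "c \<in> \<real>\<^sub>\<ge>\<^sub>0 \<Longrightarrow> positive_functional (\<lambda>x. c * \<phi> x)"
  using \<phi> by (simp add: positive_functional_def distrib_left nonneg_Reals_mult_I)

lemma pf_sandwich: "positive_functional (\<lambda>x. \<phi> (star w * x * w))"
proof -
  have "\<phi> (star w * (star a * a) * w) \<in> \<real>\<^sub>\<ge>\<^sub>0" for a
    using \<phi> unfolding positive_functional_def by (metis mult.assoc star_mult)
  then show ?thesis
    by (simp add: positive_functional_def distrib_left distrib_right pf_add mult_scaleC_left
        mult_scaleC_right pf_scaleC)
qed

end

lemma pf_sum_functional:
  assumes "\<And>k. k \<in> S \<Longrightarrow> positive_functional (f k)"
  shows "positive_functional (\<lambda>x. \<Sum>k\<in>S. f k x)"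
proof -
  have "(\<Sum>k\<in>S. f k (star a * a)) \<in> \<real>\<^sub>\<ge>\<^sub>0" for a
    using assms
    by (induction S rule: infinite_finite_induct) (auto simp: positive_functional_def)
  moreover have "f k (a + b) = f k a + f k b" "f k (scaleC c a) = c * f k a" if "k \<in> S" for k a b c
    using assms[OF that] by (simp_all add: positive_functional_def)
  ultimately show ?thesis
    by (simp add: positive_functional_def sum.distrib sum_distrib_left)
qed

section \<open>Sequences\<close>

lemma square_times_power_tendsto_zero:
  assumes "0 < q" "q < (1::real)"
  shows "(\<lambda>m. (real m + 1)\<^sup>2 * q ^ m) \<longlonglongrightarrow> 0"
proof -
  define r where "r = sqrt q"
  have r: "0 < r" "r < 1" "r\<^sup>2 = q" using assms by (simp_all add: r_def)
  have "(\<lambda>m. real m * r ^ m + r ^ m) \<longlonglongrightarrow> 0 + 0"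
    using r by (intro tendsto_add powser_times_n_limit_0 LIMSEQ_realpow_zero) auto
  then have "(\<lambda>m. (real m * r ^ m + r ^ m)\<^sup>2) \<longlonglongrightarrow> 0"
    using tendsto_power[of _ 0 sequentially 2] by simp
  moreover have "(real m * r ^ m + r ^ m)\<^sup>2 = (real m + 1)\<^sup>2 * q ^ m" for m
  proof -
    have "real m * r ^ m + r ^ m = (real m + 1) * r ^ m" by (simp add: algebra_simps)
    then show ?thesis
      by (simp add: power_mult_distrib r(3)[symmetric] power_mult[symmetric] mult.commute)
  qed
  ultimately show ?thesis by simp
qed

text \<open>Ratios of consecutive terms of a log-convex sequence increase; the cross-multiplied form
  also covers vanishing terms.\<close>

lemma log_convex_step:
  fixes a :: "nat \<Rightarrow> real"
  assumes nonneg: "\<And>k. 0 \<le> a k" and lc: "\<And>k. (a (Suc k))\<^sup>2 \<le> a k * a (Suc (Suc k))"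
  shows "a 1 * a k \<le> a 0 * a (Suc k)"
proof (induction k)
  case (Suc k)
  show ?case
  proof (cases "a (Suc k) = 0")
    case False
    then have pos: "a (Suc k) > 0" using nonneg[of "Suc k"] by simp
    have "a (Suc k) * (a 1 * a (Suc k)) = a 1 * (a (Suc k))\<^sup>2"
      by (simp add: power2_eq_square)
    also have "\<dots> \<le> a 1 * (a k * a (Suc (Suc k)))"
      by (intro mult_left_mono lc nonneg)
    also have "\<dots> = (a 1 * a k) * a (Suc (Suc k))" by simp
    also have "\<dots> \<le> (a 0 * a (Suc k)) * a (Suc (Suc k))"
      by (intro mult_right_mono Suc nonneg)
    finally show ?thesis using pos by simp
  qed (simp add: nonneg)
qed simp

lemma log_convex_power:
  fixes a :: "nat \<Rightarrow> real"
  assumes nonneg: "\<And>k. 0 \<le> a k" and lc: "\<And>k. (a (Suc k))\<^sup>2 \<le> a k * a (Suc (Suc k))"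
  shows "a 1 ^ k * a 0 \<le> a k * a 0 ^ k"
proof (induction k)
  case (Suc k)
  have "a 1 ^ Suc k * a 0 = a 1 * (a 1 ^ k * a 0)" by simp
  also have "\<dots> \<le> a 1 * (a k * a 0 ^ k)"
    by (intro mult_left_mono Suc nonneg)
  also have "\<dots> = (a 1 * a k) * a 0 ^ k" by simp
  also have "\<dots> \<le> (a 0 * a (Suc k)) * a 0 ^ k"
    by (intro mult_right_mono log_convex_step nonneg lc zero_le_power)
  finally show ?case by (simp add: mult_ac)
qed simp

text \<open>A first ratio above N would, by \<open>log_convex_power\<close>, force growth at a rate
  above N. The constant C drops out, so a crude growth bound becomes a sharp one.\<close>

lemma log_convex_ratio_le:
  fixes a :: "nat \<Rightarrow> real"
  assumes nonneg: "\<And>k. 0 \<le> a k" and lc: "\<And>k. (a (Suc k))\<^sup>2 \<le> a k * a (Suc (Suc k))"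
    and growth: "\<And>k. a k \<le> C * N ^ k" and N: "0 \<le> N"
  shows "a 1 \<le> N * a 0"
proof (rule ccontr)
  assume "\<not> a 1 \<le> N * a 0"
  then have less: "N * a 0 < a 1" by simp
  have a1: "a 1 > 0"
    using less mult_nonneg_nonneg[OF N nonneg[of 0]] by linarith
  have a0: "a 0 > 0"
    using lc[of 0] a1 nonneg[of 0] by (cases "a 0 = 0") auto
  have "N \<noteq> 0" using growth[of 1] a1 by auto
  then have Npos: "N > 0" using N by simp
  define \<rho> where "\<rho> = a 1 / (N * a 0)"
  have "\<rho> > 1" using less a0 Npos by (simp add: \<rho>_def field_simps)
  then obtain k where k: "C / a 0 < \<rho> ^ k" using real_arch_pow by blast
  have "a 1 ^ k * a 0 \<le> a k * a 0 ^ k"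
    by (rule log_convex_power[of a]) (fact nonneg lc)+
  also have "\<dots> \<le> C * N ^ k * a 0 ^ k"
    using a0 by (intro mult_right_mono growth) auto
  finally have "\<rho> ^ k * a 0 \<le> C"
    using a0 Npos by (simp add: \<rho>_def power_divide power_mult_distrib field_simps)
  with k a0 show False by (simp add: field_simps)
qed

section \<open>Moments of a positive element\<close>

lemma positive_elt_scaleC:
  assumes "positive_elt (a :: 'a::unital_star_algebra)" "0 \<le> r"
  shows "positive_elt (scaleC (of_real r) a)"
proof -
  obtain b where "a = star b * b" using assms(1) by (auto simp: positive_elt_def)
  then have "scaleC (of_real r) a = star (scaleC (of_real (sqrt r)) b) * scaleC (of_real (sqrt r)) b"
    using assms(2)
    by (simp add: star_scaleC mult_scaleC_left mult_scaleC_right scaleC_scaleC of_real_mult[symmetric]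
        del: of_real_mult)
  then show ?thesis unfolding positive_elt_def by blast
qed

lemma positive_elt_selfadjoint: "positive_elt a \<Longrightarrow> star a = a"
  by (auto simp: positive_elt_def star_mult star_star)

text \<open>Three consecutive powers appear as the inner products of two elements, ready for
  Cauchy-Schwarz. For odd k the factor b in h = star b * b stands in for a square root of h.\<close>

lemma positive_elt_powers:
  fixes h :: "'a::unital_star_algebra"
  assumes "positive_elt h"
  obtains u v where "star u * u = h ^ k" "star u * v = h ^ Suc k" "star v * v = h ^ Suc (Suc k)"
proof -
  obtain b where b: "h = star b * b" using assms by (auto simp: positive_elt_def)
  have sh: "star h = h" by (simp add: b star_mult star_star)
  have "\<exists>u v. star u * u = h ^ k \<and> star u * v = h ^ Suc k \<and> star v * v = h ^ Suc (Suc k)"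
  proof (cases "even k")
    case True
    then obtain l where l: "k = l + l" by (metis evenE mult_2)
    have "star (h ^ l) * h ^ l = h ^ k" "star (h ^ l) * h ^ Suc l = h ^ Suc k"
      "star (h ^ Suc l) * h ^ Suc l = h ^ Suc (Suc k)"
      unfolding star_power sh power_add[symmetric] l by simp_all
    then show ?thesis by blast
  next
    case False
    then obtain l where l: "k = l + l + 1" by (metis oddE mult_2)
    have *: "star (b * h ^ i) * (b * h ^ j) = h ^ (i + (j + 1))" for i j
    proof -
      have "star (b * h ^ i) * (b * h ^ j) = h ^ i * (h * h ^ j)"
        by (simp add: star_mult star_power sh mult.assoc b[symmetric])
          (simp add: b mult.assoc)
      then show ?thesis by (simp only: power_Suc[symmetric] power_add[symmetric]) simp
    qed
    have "star (b * h ^ l) * (b * h ^ l) = h ^ k" "star (b * h ^ l) * (b * h ^ Suc l) = h ^ Suc k"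
      "star (b * h ^ Suc l) * (b * h ^ Suc l) = h ^ Suc (Suc k)"
      unfolding * l by simp_all
    then show ?thesis by blast
  qed
  then show ?thesis using that by blast
qed

context
  fixes \<phi> :: "'a::unital_star_algebra \<Rightarrow> complex" and h :: 'a
  assumes \<phi>: "positive_functional \<phi>" and h: "positive_elt h"
begin

lemma pf_positive: "\<phi> h = of_real (Re (\<phi> h))" "0 \<le> Re (\<phi> h)"
  using h pf_square_real[OF \<phi>] pf_square_nonneg[OF \<phi>] by (auto simp: positive_elt_def)

lemma pf_power_nonneg: "0 \<le> Re (\<phi> (h ^ k))"
  by (metis \<phi> h pf_square_nonneg positive_elt_powers)

lemma pf_power_log_convex:
  "(Re (\<phi> (h ^ Suc k)))\<^sup>2 \<le> Re (\<phi> (h ^ k)) * Re (\<phi> (h ^ Suc (Suc k)))"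
proof -
  obtain u v where uv: "star u * u = h ^ k" "star u * v = h ^ Suc k" "star v * v = h ^ Suc (Suc k)"
    using positive_elt_powers[OF h] by blast
  have "(Re (\<phi> (h ^ Suc k)))\<^sup>2 \<le> (cmod (\<phi> (h ^ Suc k)))\<^sup>2"
    using abs_Re_le_cmod by (simp add: abs_le_square_iff[symmetric])
  also have "\<dots> \<le> Re (\<phi> (h ^ k)) * Re (\<phi> (h ^ Suc (Suc k)))"
    using pf_cauchy_schwarz[OF \<phi>, of u v] by (simp only: uv)
  finally show ?thesis .
qed

text \<open>Substitute for the operator inequality h <= N: any exponential growth rate N of the
  moments bounds each of their ratios.\<close>

lemma pf_power_ratio_le:
  assumes growth: "\<And>k. cmod (\<phi> (h ^ k)) \<le> C * N ^ k" and N: "0 \<le> N"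
  shows "Re (\<phi> (h ^ Suc k)) \<le> N * Re (\<phi> (h ^ k))"
proof -
  define a where "a j = Re (\<phi> (h ^ (j + k)))" for j
  have "a 1 \<le> N * a 0"
  proof (rule log_convex_ratio_le[where C = "C * N ^ k"])
    show "0 \<le> a j" "(a (Suc j))\<^sup>2 \<le> a j * a (Suc (Suc j))" for j
      using pf_power_nonneg[of "j + k"] pf_power_log_convex[of "j + k"] by (simp_all add: a_def)
    show "a j \<le> C * N ^ k * N ^ j" for j
      using growth[of "j + k"] complex_Re_le_cmod[of "\<phi> (h ^ (j + k))"]
      by (simp add: a_def power_add mult_ac)
  qed (rule N)
  then show ?thesis by (simp add: a_def)
qed

end


section \<open>States\<close>

lemma pf_selfadjoint_le:
  fixes a :: "'a::unital_cstar_algebra"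
  assumes pf: "positive_functional \<phi>" and "star a = a"
  shows "Re (\<phi> a) \<le> norm a * Re (\<phi> 1)"
proof -
  \<comment> \<open>The square root series needs a strict inequality, so the bound at r = norm a is
    reached only as a limit from the right.\<close>
  have "Re (\<phi> a) \<le> r * Re (\<phi> 1)" if "r > norm a" for r
    using pf_positive(2)[OF pf positive_elt_minus[OF assms(2) that]]
    by (simp add: pf_diff[OF pf] pf_scaleC[OF pf])
  moreover have "((\<lambda>r. r * Re (\<phi> 1)) \<longlongrightarrow> norm a * Re (\<phi> 1)) (at_right (norm a))"
    by (intro tendsto_intros)
  ultimately show ?thesis
    by (intro tendsto_lowerbound[where F = "at_right (norm a)"])
      (auto simp: eventually_at_right_less intro: eventually_at_rightI[of _ "norm a + 1"])
qed

lemma state_norm_le: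
  fixes a :: "'a::unital_cstar_algebra"
  assumes "state \<phi>"
  shows "cmod (\<phi> a) \<le> norm a"
proof -
  have pf: "positive_functional \<phi>" and one: "\<phi> 1 = 1"
    using assms by (auto simp: state_iff)
  have "Re (\<phi> (star a * a)) \<le> (norm a)\<^sup>2"
    using pf_selfadjoint_le[OF pf, of "star a * a"]
    by (simp add: star_mult star_star cstar_identity one)
  moreover have "(cmod (\<phi> a))\<^sup>2 \<le> Re (\<phi> (star a * a))"
    using pf_cauchy_schwarz[OF pf, of 1 a] by (simp add: one)
  ultimately show ?thesis
    by (meson norm_ge_zero order_trans power2_le_imp_le)
qed

text \<open>Weak* compactness by Tychonoff on a product of discs. The radii are an arbitrary
  function \<open>C\<close>, so that the lemma also applies to matrices, whose norm is not a class
  operation.\<close>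

lemma bounded_states_limit_point:
  fixes \<Phi> :: "nat \<Rightarrow> 'a::unital_star_algebra \<Rightarrow> complex"
  assumes st: "\<And>j. state (\<Phi> j)" and bd: "\<And>j x. cmod (\<Phi> j x) \<le> C x"
  obtains \<Psi> where "state \<Psi>" "\<And>x L. (\<lambda>j. \<Phi> j x) \<longlonglongrightarrow> L \<Longrightarrow> \<Psi> x = L"
proof -
  define K where "K = Pi\<^sub>E UNIV (\<lambda>x. cball (0::complex) (C x))"
  have "compactin (product_topology (\<lambda>_. euclidean) UNIV) K"
    by (simp add: K_def compactin_PiE)
  then have "compact K" by (simp add: euclidean_product_topology)
  moreover have "filtermap \<Phi> sequentially \<noteq> bot" by (simp add: filtermap_bot_iff)
  moreover have "eventually (\<lambda>f. f \<in> K) (filtermap \<Phi> sequentially)"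
    by (auto simp: eventually_filtermap K_def PiE_iff bd intro: always_eventually)
  ultimately obtain \<Psi> where ne: "inf (nhds \<Psi>) (filtermap \<Phi> sequentially) \<noteq> bot"
    unfolding compact_filter by blast
  \<comment> \<open>A product of discs need not be sequentially compact, so a filter finer than the
    sequence replaces a convergent subsequence.\<close>
  define G where "G = inf (nhds \<Psi>) (filtermap \<Phi> sequentially)"
  have G: "G \<noteq> bot" using ne by (simp add: G_def)
  have lim: "((\<lambda>f. f x) \<longlongrightarrow> \<Psi> x) G" for x
  proof -
    have "((\<lambda>f. f) \<longlongrightarrow> \<Psi>) G"
      by (rule tendsto_mono[OF _ filterlim_ident]) (simp add: G_def)
    then show ?thesis
      by (rule continuous_on_tendsto_compose[OF continuous_on_product_coordinates]) auto
  qed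
  have evG: "eventually P G" if "\<And>j. P (\<Phi> j)" for P
    unfolding G_def by (rule filter_leD[OF inf_le2]) (simp add: eventually_filtermap that)
  \<comment> \<open>Relations that hold for every \<open>\<Phi> j\<close> pass to the limit along
    \<open>G\<close>.\<close>
  have eq: "l = r" if "(f \<longlongrightarrow> l) G" "(g \<longlongrightarrow> r) G" "\<And>j. f (\<Phi> j) = g (\<Phi> j)"
    for f g :: "('a \<Rightarrow> complex) \<Rightarrow> complex" and l r
  proof -
    have "(f \<longlongrightarrow> r) G"
      by (rule Lim_transform_eventually[OF that(2)]) (rule evG, simp add: that(3))
    then show ?thesis using tendsto_unique[OF G that(1)] by blast
  qed
  show ?thesis
  proof
    show "state \<Psi>"
      unfolding state_def
    proof (intro conjI allI impI)
      fix a b show "\<Psi> (a + b) = \<Psi> a + \<Psi> b"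
        by (rule eq[OF lim tendsto_add[OF lim lim]]) (use st in \<open>simp add: state_def\<close>)
    next
      fix c a show "\<Psi> (scaleC c a) = c * \<Psi> a"
        by (rule eq[OF lim tendsto_mult[OF tendsto_const lim]]) (use st in \<open>simp add: state_def\<close>)
    next
      fix a :: 'a assume "positive_elt a"
      then show "\<Psi> a \<in> \<real>\<^sub>\<ge>\<^sub>0"
        by (intro Lim_in_closed_set[OF closed_nonneg_Reals_complex _ G lim] evG)
          (use st in \<open>simp add: state_def\<close>)
    next
      show "\<Psi> 1 = 1"
        by (rule eq[OF lim tendsto_const]) (use st in \<open>simp add: state_def\<close>)
    qed
  next
    fix x L assume "(\<lambda>j. \<Phi> j x) \<longlonglongrightarrow> L"
    then have "((\<lambda>f. f x) \<longlongrightarrow> L) (filtermap \<Phi> sequentially)"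
      by (simp add: filterlim_filtermap)
    then have "((\<lambda>f. f x) \<longlongrightarrow> L) G"
      by (rule tendsto_mono[rotated]) (simp add: G_def)
    then show "\<Psi> x = L" using tendsto_unique[OF G lim] by blast
  qed
qed

section \<open>Matrices and columns\<close>

lemma mat_of_mult: "mat_of (A * B) $ i $ j = (\<Sum>k\<in>UNIV. mat_of A $ i $ k * mat_of B $ k $ j)"
  by transfer (simp add: matrix_matrix_mult_def)

lemma mat_of_add [simp]: "mat_of (A + B) = mat_of A + mat_of B"
  by transfer simp

lemma mat_of_diff [simp]: "mat_of (A - B) = mat_of A - mat_of B"
  by transfer simp

lemma mat_of_zero [simp]: "mat_of 0 = 0"
  by transfer simp

lemma mat_of_one: "mat_of 1 $ i $ j = (if i = j then 1 else 0)"
  by transfer (simp add: mat_def)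

lemma mat_of_scaleC [simp]: "mat_of (scaleC c A) $ i $ j = scaleC c (mat_of A $ i $ j)"
  by transfer simp

lemma mat_of_star [simp]: "mat_of (star A) $ i $ j = star (mat_of A $ j $ i)"
  by transfer simp

lemma sqmat_eqI: "(\<And>i j. mat_of A $ i $ j = mat_of B $ i $ j) \<Longrightarrow> A = B"
  by (metis mat_of_inject vec_eq_iff)

lemma mat_of_entrywise [simp]: "mat_of (entrywise \<delta> A) $ i $ j = \<delta> (mat_of A $ i $ j)"
  by (simp add: entrywise_def Sqmat_inverse)

text \<open>For matrices over the domain the trace intertwines \<open>entrywise \<delta>\<close>
  with \<open>\<delta>\<close>; through it a state that annihilates a derivative in the algebra
  gives information on matrices.\<close>

definition mtrace :: "('a::unital_star_algebra, 'n::finite) sqmat \<Rightarrow> 'a" where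
  "mtrace A = (\<Sum>i\<in>UNIV. mat_of A $ i $ i)"

lemma mtrace_sum: "mtrace (sum f S) = (\<Sum>k\<in>S. mtrace (f k))"
proof -
  have "mat_of (sum f S) $ i $ j = (\<Sum>k\<in>S. mat_of (f k) $ i $ j)" for i j
    by (induction S rule: infinite_finite_induct) simp_all
  then show ?thesis by (simp add: mtrace_def sum.swap[of _ S])
qed

lemma pf_diagonal_entry:
  assumes "positive_functional \<phi>"
  shows "positive_functional (\<lambda>A. \<phi> (mat_of A $ k $ k))"
proof -
  have "\<phi> (\<Sum>i\<in>UNIV. star (f i) * f i) \<in> \<real>\<^sub>\<ge>\<^sub>0" for f :: "'b \<Rightarrow> 'a"
  proof -
    have "(\<Sum>i\<in>S. \<phi> (star (f i) * f i)) \<in> \<real>\<^sub>\<ge>\<^sub>0" for S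
      using assms by (induction S rule: infinite_finite_induct) (auto simp: positive_functional_def)
    then show ?thesis by (simp add: pf_sum[OF assms])
  qed
  then show ?thesis
    using assms by (simp add: positive_functional_def mat_of_mult)
qed

lemma pf_trace:
  assumes "positive_functional \<phi>"
  shows "positive_functional (\<lambda>A. \<phi> (mtrace A))"
  unfolding mtrace_def pf_sum[OF assms]
  by (intro pf_sum_functional pf_diagonal_entry assms)

definition colinner :: "'a::unital_star_algebra ^ 'n \<Rightarrow> 'a ^ 'n \<Rightarrow> 'a" where
  "colinner x y = (\<Sum>i\<in>UNIV. star (x $ i) * y $ i)"

lemma star_colinner: "star (colinner x y) = colinner y x"
  by (simp add: colinner_def star_sum star_mult star_star)

lemma colinner_add_left: "colinner (x + y) z = colinner x z + colinner y z"
  by (simp add: colinner_def star_add distrib_right sum.distrib)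

lemma colinner_add_right: "colinner x (y + z) = colinner x y + colinner x z"
  by (simp add: colinner_def distrib_left sum.distrib)

lemma colinner_adjoint:
  "colinner (mat_of A *v x) y = colinner x (mat_of (star A) *v y)"
proof -
  have "colinner (mat_of A *v x) y
      = (\<Sum>i\<in>UNIV. \<Sum>j\<in>UNIV. star (x $ j) * (star (mat_of A $ i $ j) * y $ i))"
    by (simp add: colinner_def matrix_vector_mult_def star_sum star_mult sum_distrib_right mult.assoc)
  also have "\<dots> = (\<Sum>j\<in>UNIV. \<Sum>i\<in>UNIV. star (x $ j) * (star (mat_of A $ i $ j) * y $ i))"
    by (rule sum.swap)
  also have "\<dots> = colinner x (mat_of (star A) *v y)"
    by (simp add: colinner_def matrix_vector_mult_def sum_distrib_left)
  finally show ?thesis .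
qed

lemma pf_colinner_nonneg:
  assumes "positive_functional \<phi>"
  shows "0 \<le> Re (\<phi> (colinner x x))"
  unfolding colinner_def pf_sum[OF assms] Re_sum by (intro sum_nonneg pf_square_nonneg[OF assms])

lemma pf_colinner_cauchy_schwarz:
  assumes "positive_functional \<phi>"
  shows "(cmod (\<phi> (colinner x y)))\<^sup>2 \<le> Re (\<phi> (colinner x x)) * Re (\<phi> (colinner y y))"
proof -
  \<comment> \<open>Columns are placed in matrices, whose products \<open>star X * Y\<close> have inner products as entries.\<close>
  have entry: "mat_of (star (Sqmat (\<chi> i j. u $ i)) * Sqmat (\<chi> i j. v $ i)) $ k $ k = colinner u v"
    for u v k
    by (simp add: mat_of_mult colinner_def Sqmat_inverse)
  show ?thesis
    using pf_cauchy_schwarz[OF pf_diagonal_entry[OF assms], where a = "Sqmat (\<chi> i j. x $ i)"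
        and b = "Sqmat (\<chi> i j. y $ i)"]
    by (simp only: entry)
qed

lemma column_norm_square: "(column_norm x)\<^sup>2 = norm (colinner x x)"
  by (simp add: column_norm_def colinner_def)

lemma column_norm_nonneg: "0 \<le> column_norm x"
  by (simp add: column_norm_def)

lemma column_norm_zero [simp]: "column_norm 0 = 0"
  by (simp add: column_norm_def)

lemma column_norm_scaleC: "column_norm (\<chi> i. scaleC c (x $ i)) = cmod c * column_norm x"
proof -
  have "colinner (\<chi> i. scaleC c (x $ i)) (\<chi> i. scaleC c (x $ i)) = scaleC (c * cnj c) (colinner x x)"
    by (simp add: colinner_def star_scaleC mult_scaleC_left mult_scaleC_right scaleC_scaleC scaleC_sum
        mult.commute)
  then have "(column_norm (\<chi> i. scaleC c (x $ i)))\<^sup>2 = (cmod c * column_norm x)\<^sup>2"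
    by (simp add: column_norm_square norm_scaleC power_mult_distrib norm_mult
        power2_eq_square[of "cmod c"])
  then show ?thesis
    by (simp add: power2_eq_iff_nonneg column_norm_nonneg)
qed

lemma column_norm_le_sum: "column_norm x \<le> (\<Sum>i\<in>UNIV. norm (x $ i))"
proof (rule power2_le_imp_le)
  have "(column_norm x)\<^sup>2 \<le> (\<Sum>i\<in>UNIV. norm (star (x $ i) * x $ i))"
    unfolding column_norm_square colinner_def by (rule norm_sum)
  also have "\<dots> = (\<Sum>i\<in>UNIV. norm (x $ i) * norm (x $ i))"
    by (simp add: cstar_identity power2_eq_square)
  also have "\<dots> \<le> (\<Sum>i\<in>UNIV. norm (x $ i) * (\<Sum>j\<in>UNIV. norm (x $ j)))"
    by (intro sum_mono mult_left_mono member_le_sum) auto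
  also have "\<dots> = (\<Sum>i\<in>UNIV. norm (x $ i))\<^sup>2"
    by (simp add: sum_distrib_right power2_eq_square)
  finally show "(column_norm x)\<^sup>2 \<le> (\<Sum>i\<in>UNIV. norm (x $ i))\<^sup>2" .
qed (simp add: sum_nonneg)


section \<open>The operator norm\<close>

text \<open>The norm is a parameter so that the same rules can be interpreted for
  \<open>entrywise \<delta>\<close> with \<open>operator_norm\<close>.\<close>

locale partial_derivation =
  fixes N :: "'a::unital_star_algebra \<Rightarrow> real" and D :: "'a set" and \<delta> :: "'a \<Rightarrow> 'a"
  assumes derivation: "star_derivation N D \<delta>"
begin

lemma D_one: "1 \<in> D" and D_add: "\<And>a b. a \<in> D \<Longrightarrow> b \<in> D \<Longrightarrow> a + b \<in> D"
  and D_scaleC: "\<And>c a. a \<in> D \<Longrightarrow> scaleC c a \<in> D"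
  and D_mult: "\<And>a b. a \<in> D \<Longrightarrow> b \<in> D \<Longrightarrow> a * b \<in> D"
  and D_star: "\<And>a. a \<in> D \<Longrightarrow> star a \<in> D"
  and \<delta>_add: "\<And>a b. a \<in> D \<Longrightarrow> b \<in> D \<Longrightarrow> \<delta> (a + b) = \<delta> a + \<delta> b"
  and \<delta>_scaleC: "\<And>c a. a \<in> D \<Longrightarrow> \<delta> (scaleC c a) = scaleC c (\<delta> a)"
  and \<delta>_mult: "\<And>a b. a \<in> D \<Longrightarrow> b \<in> D \<Longrightarrow> \<delta> (a * b) = \<delta> a * b + a * \<delta> b"
  and \<delta>_star: "\<And>a. a \<in> D \<Longrightarrow> \<delta> (star a) = star (\<delta> a)"
  and dense: "\<And>a \<epsilon>. \<epsilon> > 0 \<Longrightarrow> \<exists>d\<in>D. N (a - d) < \<epsilon>"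
  using derivation by (auto simp: star_derivation_def unital_star_subalgebra_def norm_dense_def)

lemma D_zero: "0 \<in> D"
  using D_scaleC[OF D_one, of 0] by simp

lemma \<delta>_zero: "\<delta> 0 = 0"
  using \<delta>_scaleC[OF D_one, of 0] by simp

lemma \<delta>_one: "\<delta> 1 = 0"
  using \<delta>_mult[OF D_one D_one] by simp

lemma D_sum: "(\<And>k. k \<in> S \<Longrightarrow> f k \<in> D) \<Longrightarrow> sum f S \<in> D"
  by (induction S rule: infinite_finite_induct) (auto simp: D_zero D_add)

lemma \<delta>_sum: "(\<And>k. k \<in> S \<Longrightarrow> f k \<in> D) \<Longrightarrow> \<delta> (sum f S) = (\<Sum>k\<in>S. \<delta> (f k))"
  by (induction S rule: infinite_finite_induct) (auto simp: \<delta>_zero \<delta>_add D_sum)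

lemma D_power: "a \<in> D \<Longrightarrow> a ^ k \<in> D"
  by (induction k) (auto simp: D_one D_mult)

end

text \<open>The estimates for columns and matrices live in this locale because the states that prove
  them come from \<open>norming_state\<close>.\<close>

locale well_behaved_derivation = partial_derivation norm D \<delta>
  for D :: "'a::unital_cstar_algebra set" and \<delta> :: "'a \<Rightarrow> 'a" +
  assumes behaved: "well_behaved norm D \<delta>"
begin

lemma norming_state:
  assumes "a \<in> D" "positive_elt a"
  obtains \<phi> where "state \<phi>" "\<phi> a = of_real (norm a)" "\<phi> (\<delta> a) = 0"
  using behaved assms by (auto simp: well_behaved_def)

text \<open>Lets states compare norms. For d in the domain, \<open>star d * d\<close> is a positive
  element of the domain and has a norming state; elements d approximating b carry the bound over to
  b.\<close>

lemma norm_square_le_if_states: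
  fixes b :: 'a
  assumes le: "\<And>\<phi>. state \<phi> \<Longrightarrow> Re (\<phi> (star b * b)) \<le> r"
  shows "(norm b)\<^sup>2 \<le> r"
proof -
  have "\<exists>d\<in>D. norm (b - d) < inverse (real (Suc j))" for j
    by (rule dense) simp
  then obtain d where dD: "d j \<in> D" and d: "norm (b - d j) < inverse (real (Suc j))" for j
    by metis
  have "(\<lambda>j. b - d j) \<longlonglongrightarrow> 0"
    by (rule tendsto_norm_zero_cancel, rule tendsto_sandwich[OF _ _ tendsto_const LIMSEQ_inverse_real_of_nat])
      (use d in \<open>auto intro!: always_eventually less_imp_le\<close>)
  then have lim: "d \<longlonglongrightarrow> b"
    using tendsto_diff[OF tendsto_const[of b], of "\<lambda>j. b - d j" 0] by simp
  have "(norm (d j))\<^sup>2 - norm (star b * b - star (d j) * d j) \<le> r" for j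
  proof -
    obtain \<phi> where \<phi>: "state \<phi>" "\<phi> (star (d j) * d j) = of_real (norm (star (d j) * d j))"
      by (rule norming_state[OF D_mult[OF D_star[OF dD[of j]] dD[of j]]]) (auto simp: positive_elt_def)
    have pf: "positive_functional \<phi>" using \<phi>(1) by (simp add: state_iff)
    have "- norm (star b * b - star (d j) * d j) \<le> Re (\<phi> (star b * b - star (d j) * d j))"
      using state_norm_le[OF \<phi>(1), of "star b * b - star (d j) * d j"]
        abs_Re_le_cmod[of "\<phi> (star b * b - star (d j) * d j)"] by linarith
    also have "\<dots> = Re (\<phi> (star b * b)) - (norm (d j))\<^sup>2"
      by (simp add: pf_diff[OF pf] \<phi>(2) cstar_identity)
    finally show ?thesis using le[OF \<phi>(1)] by simp
  qed
  moreover have "(\<lambda>j. (norm (d j))\<^sup>2 - norm (star b * b - star (d j) * d j))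
      \<longlonglongrightarrow> (norm b)\<^sup>2 - norm (star b * b - star b * b)"
    by (intro tendsto_intros lim bounded_linear.tendsto[OF bounded_linear_star])
  ultimately show ?thesis
    by (simp add: LIMSEQ_le_const2)
qed

text \<open>Cauchy-Schwarz in the Hilbert module. Multiplying x on the right by z = <x, y> turns the
  inner product into \<open>star z * z\<close>. A state applied to
  \<open>star z * colinner x x * z\<close> is at most the norm of the middle factor times its value
  at \<open>star z * z\<close>, so one such value cancels.\<close>

lemma norm_colinner_le:
  fixes x y :: "'a ^ 'n"
  shows "norm (colinner x y) \<le> column_norm x * column_norm y"
proof -
  define z where "z = colinner x y"
  define xz where "xz = (\<chi> i. x $ i * z)"
  have xz: "colinner xz v = star z * colinner x v" "colinner v xz = colinner v x * z" for v
    by (simp_all add: colinner_def xz_def star_mult sum_distrib_left sum_distrib_right mult.assoc)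
  have xz_y: "colinner xz y = star z * z"
    by (simp add: xz z_def)
  have xz_xz: "colinner xz xz = star z * colinner x x * z"
    by (simp add: xz mult.assoc)
  have "(norm z)\<^sup>2 \<le> norm (colinner x x) * norm (colinner y y)"
  proof (rule norm_square_le_if_states)
    fix \<phi> :: "'a \<Rightarrow> complex" assume st: "state \<phi>"
    then have pf: "positive_functional \<phi>" by (simp add: state_iff)
    define r where "r = Re (\<phi> (star z * z))"
    have "r \<ge> 0" unfolding r_def by (rule pf_square_nonneg[OF pf])
    have "r\<^sup>2 \<le> (cmod (\<phi> (star z * z)))\<^sup>2"
      unfolding r_def using abs_Re_le_cmod by (simp add: abs_le_square_iff[symmetric])
    also have "\<dots> \<le> Re (\<phi> (star z * colinner x x * z)) * Re (\<phi> (colinner y y))"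
      using pf_colinner_cauchy_schwarz[OF pf, of xz y] by (simp add: xz_y xz_xz)
    also have "\<dots> \<le> (norm (colinner x x) * r) * norm (colinner y y)"
    proof (rule mult_mono)
      show "Re (\<phi> (star z * colinner x x * z)) \<le> norm (colinner x x) * r"
        using pf_selfadjoint_le[OF pf_sandwich[OF pf, of z], of "colinner x x"]
        by (simp add: star_colinner r_def)
      show "Re (\<phi> (colinner y y)) \<le> norm (colinner y y)"
        using state_norm_le[OF st] complex_Re_le_cmod order_trans by blast
    qed (use \<open>r \<ge> 0\<close> in \<open>simp_all add: pf_colinner_nonneg[OF pf]\<close>)
    finally have "r * r \<le> r * (norm (colinner x x) * norm (colinner y y))"
      by (simp add: power2_eq_square mult_ac)
    then show "Re (\<phi> (star z * z)) \<le> norm (colinner x x) * norm (colinner y y)"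
      using \<open>r \<ge> 0\<close> unfolding r_def[symmetric] by (cases "r = 0") auto
  qed
  then have "(norm z)\<^sup>2 \<le> (column_norm x * column_norm y)\<^sup>2"
    by (simp add: power_mult_distrib column_norm_square)
  then show ?thesis
    unfolding z_def by (rule power2_le_imp_le) (simp add: column_norm_nonneg)
qed

lemma norm_component_le: "norm (x $ j) \<le> column_norm (x :: 'a ^ 'n)"
proof -
  have "(norm (x $ j))\<^sup>2 \<le> (column_norm x)\<^sup>2"
  proof (rule norm_square_le_if_states)
    fix \<phi> :: "'a \<Rightarrow> complex" assume st: "state \<phi>"
    then have pf: "positive_functional \<phi>" by (simp add: state_iff)
    have "Re (\<phi> (star (x $ j) * x $ j)) \<le> (\<Sum>i\<in>UNIV. Re (\<phi> (star (x $ i) * x $ i)))"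
      by (rule member_le_sum) (auto simp: pf_square_nonneg[OF pf])
    also have "\<dots> = Re (\<phi> (colinner x x))"
      by (simp add: colinner_def pf_sum[OF pf])
    also have "\<dots> \<le> (column_norm x)\<^sup>2"
      unfolding column_norm_square using state_norm_le[OF st] complex_Re_le_cmod order_trans by blast
    finally show "Re (\<phi> (star (x $ j) * x $ j)) \<le> (column_norm x)\<^sup>2" .
  qed
  then show ?thesis by (rule power2_le_imp_le) (rule column_norm_nonneg)
qed

lemma column_norm_triangle: "column_norm (x + y) \<le> column_norm x + column_norm (y :: 'a ^ 'n)"
proof (rule power2_le_imp_le)
  have "(column_norm (x + y))\<^sup>2
      = norm ((colinner x x + colinner x y) + (colinner y x + colinner y y))"
    by (simp add: column_norm_square colinner_add_left colinner_add_right algebra_simps)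
  also have "\<dots> \<le> (norm (colinner x x) + norm (colinner x y)) + (norm (colinner y x) + norm (colinner y y))"
    by (meson add_mono norm_triangle_ineq order_trans)
  also have "\<dots> \<le> (column_norm x)\<^sup>2 + column_norm x * column_norm y
      + (column_norm y * column_norm x + (column_norm y)\<^sup>2)"
    by (intro add_mono norm_colinner_le) (simp_all add: column_norm_square)
  also have "\<dots> = (column_norm x + column_norm y)\<^sup>2"
    by (simp add: power2_eq_square algebra_simps)
  finally show "(column_norm (x + y))\<^sup>2 \<le> (column_norm x + column_norm y)\<^sup>2" .
qed (simp add: column_norm_nonneg)

lemma column_norm_mult_le_entries:
  "column_norm (mat_of A *v x) \<le> (\<Sum>i\<in>UNIV. \<Sum>j\<in>UNIV. norm (mat_of A $ i $ j)) * column_norm (x :: 'a ^ 'n)"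
proof -
  have "column_norm (mat_of A *v x) \<le> (\<Sum>i\<in>UNIV. norm (\<Sum>j\<in>UNIV. mat_of A $ i $ j * x $ j))"
    using column_norm_le_sum[of "mat_of A *v x"] by (simp add: matrix_vector_mult_def)
  also have "\<dots> \<le> (\<Sum>i\<in>UNIV. \<Sum>j\<in>UNIV. norm (mat_of A $ i $ j) * column_norm x)"
  proof (rule sum_mono, rule sum_norm_le)
    fix i j
    have "norm (mat_of A $ i $ j * x $ j) \<le> norm (mat_of A $ i $ j) * norm (x $ j)"
      by (rule norm_mult_ineq)
    also have "\<dots> \<le> norm (mat_of A $ i $ j) * column_norm x"
      by (intro mult_left_mono norm_component_le) simp
    finally show "norm (mat_of A $ i $ j * x $ j) \<le> norm (mat_of A $ i $ j) * column_norm x" .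
  qed
  finally show ?thesis by (simp add: sum_distrib_right)
qed

lemma operator_norm_leI:
  fixes A :: "('a, 'n::finite) sqmat"
  assumes "0 \<le> K" "\<And>x. column_norm x \<le> 1 \<Longrightarrow> column_norm (mat_of A *v x) \<le> K"
  shows "operator_norm A \<le> K"
  unfolding operator_norm_def
proof (rule cSUP_least)
  show "{x :: 'a ^ 'n. column_norm x \<le> 1} \<noteq> {}"
    using column_norm_zero by (auto intro: exI[of _ 0])
qed (use assms in auto)

lemma operator_norm_upper:
  fixes A :: "('a, 'n::finite) sqmat"
  assumes "column_norm x \<le> 1"
  shows "column_norm (mat_of A *v x) \<le> operator_norm A"
  unfolding operator_norm_def
proof (rule cSUP_upper)
  let ?K = "\<Sum>i\<in>UNIV. \<Sum>j\<in>UNIV. norm (mat_of A $ i $ j)"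
  have "column_norm (mat_of A *v x) \<le> ?K" if "column_norm x \<le> 1" for x
    using order_trans[OF column_norm_mult_le_entries mult_left_mono[OF that, of ?K]]
    by (simp add: sum_nonneg)
  then show "bdd_above ((\<lambda>x. column_norm (mat_of A *v x)) ` {x. column_norm x \<le> 1})"
    by (intro bdd_aboveI2[where M = ?K]) auto
qed (use assms in auto)

lemma operator_norm_nonneg: "0 \<le> operator_norm (A :: ('a, 'n::finite) sqmat)"
  using operator_norm_upper[of 0 A] column_norm_nonneg order_trans by fastforce

lemma column_norm_mult_le: "column_norm (mat_of A *v x) \<le> operator_norm A * column_norm (x :: 'a ^ 'n::finite)"
proof (cases "column_norm x = 0")
  case True
  then have "x = 0" using norm_component_le[of x] by (simp add: vec_eq_iff)
  then show ?thesis by simp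
next
  case False
  then have pos: "column_norm x > 0" using column_norm_nonneg[of x] by simp
  define c where "c = complex_of_real (1 / column_norm x)"
  have c: "cmod c = 1 / column_norm x" using pos by (simp add: c_def norm_divide)
  define y where "y = (\<chi> i. scaleC c (x $ i))"
  have "mat_of A *v y = (\<chi> i. scaleC c ((mat_of A *v x) $ i))"
    by (simp add: y_def matrix_vector_mult_def vec_eq_iff mult_scaleC_right scaleC_sum)
  then have "column_norm (mat_of A *v y) = column_norm (mat_of A *v x) / column_norm x"
    by (simp add: column_norm_scaleC c)
  moreover have "column_norm y \<le> 1" using pos by (simp add: y_def column_norm_scaleC c)
  ultimately have "column_norm (mat_of A *v x) / column_norm x \<le> operator_norm A"
    using operator_norm_upper[of y A] by simp
  then show ?thesis using pos by (simp add: field_simps)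
qed

lemma operator_norm_le_entries:
  "operator_norm (A :: ('a, 'n::finite) sqmat) \<le> (\<Sum>i\<in>UNIV. \<Sum>j\<in>UNIV. norm (mat_of A $ i $ j))"
proof (rule operator_norm_leI)
  let ?K = "\<Sum>i\<in>UNIV. \<Sum>j\<in>UNIV. norm (mat_of A $ i $ j)"
  show K: "0 \<le> ?K" by (intro sum_nonneg) simp
  show "column_norm (mat_of A *v x) \<le> ?K" if "column_norm x \<le> 1" for x
    using order_trans[OF column_norm_mult_le_entries mult_left_mono[OF that K]] by simp
qed

lemma operator_norm_add:
  "operator_norm (A + B) \<le> operator_norm A + operator_norm (B :: ('a, 'n::finite) sqmat)"
proof (rule operator_norm_leI)
  show "column_norm (mat_of (A + B) *v x) \<le> operator_norm A + operator_norm B"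
    if "column_norm x \<le> 1" for x
  proof -
    have "column_norm (mat_of (A + B) *v x) \<le> column_norm (mat_of A *v x) + column_norm (mat_of B *v x)"
      by (simp add: matrix_vector_mult_add_rdistrib column_norm_triangle)
    also have "\<dots> \<le> operator_norm A + operator_norm B"
      by (intro add_mono operator_norm_upper that)
    finally show ?thesis .
  qed
qed (simp add: operator_norm_nonneg)

lemma operator_norm_sum:
  "operator_norm (sum f S) \<le> (\<Sum>k\<in>S. operator_norm (f k :: ('a, 'n::finite) sqmat))"
proof (induction S rule: infinite_finite_induct)
  case (insert k S)
  then show ?case using operator_norm_add[of "f k" "sum f S"] by simp
qed (use operator_norm_leI[of 0 0] in simp_all)

lemma mat_of_mult_vec: "mat_of (A * B) *v x = mat_of A *v (mat_of B *v (x :: 'a ^ 'n::finite))"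
  by (simp add: times_sqmat.rep_eq matrix_vector_mul_assoc)

lemma operator_norm_mult:
  "operator_norm (A * B) \<le> operator_norm A * operator_norm (B :: ('a, 'n::finite) sqmat)"
proof (rule operator_norm_leI)
  show "column_norm (mat_of (A * B) *v x) \<le> operator_norm A * operator_norm B"
    if "column_norm x \<le> 1" for x
  proof -
    have "column_norm (mat_of (A * B) *v x) \<le> operator_norm A * column_norm (mat_of B *v x)"
      unfolding mat_of_mult_vec by (rule column_norm_mult_le)
    also have "\<dots> \<le> operator_norm A * operator_norm B"
      by (intro mult_left_mono operator_norm_upper that operator_norm_nonneg)
    finally show ?thesis .
  qed
qed (simp add: operator_norm_nonneg)

lemma operator_norm_power:
  "operator_norm (A ^ k) \<le> operator_norm (A :: ('a, 'n::finite) sqmat) ^ k"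
proof (induction k)
  case 0
  show ?case
    by (rule operator_norm_leI) (simp_all add: one_sqmat.rep_eq)
next
  case (Suc k)
  then show ?case
    using order_trans[OF operator_norm_mult mult_left_mono[OF Suc operator_norm_nonneg]] by simp
qed

lemma operator_norm_scaleC:
  "operator_norm (scaleC c A) = cmod c * operator_norm (A :: ('a, 'n::finite) sqmat)"
proof -
  have le: "operator_norm (scaleC c A) \<le> cmod c * operator_norm A" for c and A :: "('a, 'n) sqmat"
  proof (rule operator_norm_leI)
    fix x :: "'a ^ 'n" assume "column_norm x \<le> 1"
    have "mat_of (scaleC c A) *v x = (\<chi> i. scaleC c ((mat_of A *v x) $ i))"
      by (simp add: matrix_vector_mult_def vec_eq_iff mult_scaleC_left scaleC_sum)
    then show "column_norm (mat_of (scaleC c A) *v x) \<le> cmod c * operator_norm A"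
      using operator_norm_upper[OF \<open>column_norm x \<le> 1\<close>, of A]
      by (simp add: column_norm_scaleC mult_left_mono)
  qed (simp add: operator_norm_nonneg)
  show ?thesis
  proof (cases "c = 0")
    case True
    then show ?thesis using le[of 0 A] operator_norm_nonneg[of "scaleC 0 A"] by simp
  next
    case False
    have "operator_norm A \<le> cmod (inverse c) * operator_norm (scaleC c A)"
      using le[of "inverse c" "scaleC c A"] False by (simp add: scaleC_scaleC scaleC_one)
    then have "cmod c * operator_norm A \<le> operator_norm (scaleC c A)"
      using False by (simp add: norm_divide field_simps)
    with le[of c A] show ?thesis by simp
  qed
qed

lemma norm_entry_le: "norm (mat_of A $ i $ j) \<le> operator_norm (A :: ('a, 'n::finite) sqmat)"
proof -
  have "column_norm (axis j 1 :: 'a ^ 'n) \<le> 1"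
    using column_norm_le_sum[of "axis j 1 :: 'a ^ 'n"]
    by (simp add: axis_def if_distrib[of norm] cong: if_cong)
  then have "column_norm (mat_of A *v axis j 1) \<le> operator_norm A"
    by (rule operator_norm_upper)
  moreover have "(mat_of A *v axis j 1) $ i = mat_of A $ i $ j"
    by (simp add: matrix_vector_mult_def axis_def if_distrib cong: if_cong)
  ultimately show ?thesis
    using norm_component_le[of "mat_of A *v axis j 1" i] by simp
qed

text \<open>The norms of \<open>A ^ j\<close> applied to x are log-convex in j: one factor
  \<open>A\<close> moves across the inner product, and \<open>norm_colinner_le\<close> applies. A
  column of norm at most 1 starts the sequence at or below 1.\<close>

lemma operator_norm_power_ge:
  fixes A :: "('a, 'n::finite) sqmat"
  assumes A: "star A = A"
  shows "operator_norm A ^ k \<le> operator_norm (A ^ k)"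
proof (cases "k = 0")
  case True
  have "1 \<le> operator_norm (1 :: ('a, 'n) sqmat)"
    using norm_entry_le[of "1 :: ('a, 'n) sqmat" undefined undefined] by (simp add: mat_of_one)
  then show ?thesis using True by simp
next
  case False
  have "operator_norm A \<le> root k (operator_norm (A ^ k))"
  proof (rule operator_norm_leI)
    fix x :: "'a ^ 'n" assume x: "column_norm x \<le> 1"
    define b where "b j = column_norm (mat_of (A ^ j) *v x)" for j
    have b_nonneg: "0 \<le> b j" for j by (simp add: b_def column_norm_nonneg)
    have b_lc: "(b (Suc j))\<^sup>2 \<le> b j * b (Suc (Suc j))" for j
    proof -
      define y where "y = mat_of (A ^ j) *v x"
      have "(b (Suc j))\<^sup>2 = norm (colinner (mat_of A *v y) (mat_of A *v y))"
        by (simp add: b_def column_norm_square y_def mat_of_mult_vec)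
      also have "\<dots> = norm (colinner y (mat_of A *v (mat_of A *v y)))"
        by (simp add: colinner_adjoint A)
      also have "\<dots> \<le> column_norm y * column_norm (mat_of A *v (mat_of A *v y))"
        by (rule norm_colinner_le)
      also have "\<dots> = b j * b (Suc (Suc j))"
        by (simp add: b_def y_def mat_of_mult_vec)
      finally show ?thesis .
    qed
    have b0: "b 0 \<le> 1" using x by (simp add: b_def one_sqmat.rep_eq)
    have "b 1 ^ k \<le> b k"
    proof (cases "b 0 = 0")
      case True
      then have "b 1 = 0" using b_lc[of 0] by simp
      then show ?thesis using False b_nonneg[of k] by (simp add: zero_power)
    next
      case b0_nz: False
      then have b0_pos: "b 0 > 0" using b_nonneg[of 0] by simp
      obtain l where l: "k = Suc l" using False not0_implies_Suc by blast
      have "b 1 ^ k * b 0 \<le> b k * b 0 ^ k"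
        by (rule log_convex_power[of b]) (fact b_nonneg b_lc)+
      also have "\<dots> = b k * b 0 ^ l * b 0" by (simp add: l)
      finally have "b 1 ^ k \<le> b k * b 0 ^ l" using b0_pos by simp
      also have "\<dots> \<le> b k * 1"
        using b0 by (intro mult_left_mono b_nonneg power_le_one) (simp_all add: b_nonneg)
      finally show ?thesis by simp
    qed
    also have "b k \<le> operator_norm (A ^ k)"
      unfolding b_def by (rule operator_norm_upper[OF x])
    finally have *: "b 1 ^ k \<le> operator_norm (A ^ k)" .
    have "b 1 = root k (b 1 ^ k)"
      using False b_nonneg[of 1] by (subst real_root_power_cancel) auto
    also have "\<dots> \<le> root k (operator_norm (A ^ k))"
      using * False by (intro real_root_le_mono) auto
    finally show "column_norm (mat_of A *v x) \<le> root k (operator_norm (A ^ k))"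
      by (simp add: b_def)
  qed (simp add: operator_norm_nonneg real_root_ge_zero)
  then have "operator_norm A ^ k \<le> root k (operator_norm (A ^ k)) ^ k"
    by (rule power_mono) (rule operator_norm_nonneg)
  then show ?thesis
    using False by (simp add: real_root_pow_pos2 operator_norm_nonneg)
qed


section \<open>The derivation on matrices\<close>

lemma star_derivation_entrywise:
  "star_derivation operator_norm (matrices_over D :: ('a, 'n::finite) sqmat set) (entrywise \<delta>)"
  unfolding star_derivation_def unital_star_subalgebra_def norm_dense_def
proof (intro conjI ballI allI impI)
  fix A B :: "('a, 'n) sqmat" and c :: complex
  assume A: "A \<in> matrices_over D"
  show "scaleC c A \<in> matrices_over D" "star A \<in> matrices_over D"
    using A by (simp_all add: matrices_over_def D_scaleC D_star)
  show "entrywise \<delta> (scaleC c A) = scaleC c (entrywise \<delta> A)"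
    "entrywise \<delta> (star A) = star (entrywise \<delta> A)"
    using A by (auto intro!: sqmat_eqI simp: matrices_over_def \<delta>_scaleC \<delta>_star)
  assume B: "B \<in> matrices_over D"
  show "A + B \<in> matrices_over D" "A * B \<in> matrices_over D"
    using A B by (auto simp: matrices_over_def D_add mat_of_mult intro!: D_sum D_mult)
  show "entrywise \<delta> (A + B) = entrywise \<delta> A + entrywise \<delta> B"
    using A B by (auto intro!: sqmat_eqI simp: matrices_over_def \<delta>_add)
  show "entrywise \<delta> (A * B) = entrywise \<delta> A * B + A * entrywise \<delta> B"
    using A B
    by (auto intro!: sqmat_eqI simp: matrices_over_def mat_of_mult \<delta>_sum D_mult \<delta>_mult sum.distrib)
next
  show "1 \<in> (matrices_over D :: ('a, 'n) sqmat set)"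
    by (simp add: matrices_over_def mat_of_one D_one D_zero)
next
  fix A :: "('a, 'n) sqmat" and \<epsilon> :: real assume "\<epsilon> > 0"
  \<comment> \<open>The number of entries. The extra factor 2 in the tolerance leaves room for the
    strict inequality.\<close>
  define K where "K = real CARD('n) * real CARD('n)"
  have "K > 0" by (simp add: K_def)
  have "\<exists>d\<in>D. norm (mat_of A $ i $ j - d) < \<epsilon> / (2 * K)" for i j
    using \<open>\<epsilon> > 0\<close> \<open>K > 0\<close> by (intro dense) simp
  then obtain d where d: "d i j \<in> D" "norm (mat_of A $ i $ j - d i j) < \<epsilon> / (2 * K)" for i j
    by metis
  define B where "B = Sqmat (\<chi> i j. d i j)"
  have B: "mat_of B $ i $ j = d i j" for i j
    by (simp add: B_def Sqmat_inverse)
  have "operator_norm (A - B) \<le> (\<Sum>i\<in>UNIV. \<Sum>j\<in>UNIV. norm (mat_of A $ i $ j - d i j))"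
    using operator_norm_le_entries[of "A - B"] by (simp add: B)
  also have "\<dots> \<le> (\<Sum>i\<in>(UNIV :: 'n set). \<Sum>j\<in>(UNIV :: 'n set). \<epsilon> / (2 * K))"
    by (intro sum_mono less_imp_le d)
  also have "\<dots> = \<epsilon> / 2" using \<open>K > 0\<close> by (simp add: K_def)
  also have "\<dots> < \<epsilon>" using \<open>\<epsilon> > 0\<close> by simp
  finally show "\<exists>B\<in>matrices_over D. operator_norm (A - B) < \<epsilon>"
    by (intro bexI[of _ B]) (simp_all add: matrices_over_def B d)
qed

section \<open>States and the trace of powers\<close>

lemma norming_state_selfadjoint:
  assumes "a \<in> D" "star a = a"
  obtains \<phi> where "state \<phi>" "\<phi> (\<delta> a) = 0" "\<And>\<psi>. state \<psi> \<Longrightarrow> Re (\<psi> a) \<le> Re (\<phi> a)"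
proof -
  \<comment> \<open>Adding a scalar makes the element positive, changes all states by the same
    amount and leaves \<open>\<delta>\<close> unchanged; norming the shifted element therefore means
    maximising over states. The 1 provides the strict inequality in
    \<open>positive_elt_minus\<close>.\<close>
  define c where "c = complex_of_real (norm a + 1)"
  define x where "x = scaleC c 1 + a"
  have "positive_elt (scaleC c 1 - (- a))"
    unfolding c_def by (rule positive_elt_minus) (simp_all add: star_minus assms)
  then have "positive_elt x" by (simp add: x_def)
  moreover have "x \<in> D" by (simp add: x_def D_add D_scaleC D_one assms)
  ultimately obtain \<phi> where \<phi>: "state \<phi>" "\<phi> x = of_real (norm x)" "\<phi> (\<delta> x) = 0"
    using norming_state by blast
  have val: "\<psi> x = c + \<psi> a" if "state \<psi>" for \<psi>
    using that by (simp add: x_def state_def)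
  show ?thesis
  proof
    show "\<phi> (\<delta> a) = 0"
      using \<phi>(3) by (simp add: x_def \<delta>_add \<delta>_scaleC \<delta>_one D_scaleC D_one assms)
    fix \<psi> :: "'a \<Rightarrow> complex" assume \<psi>: "state \<psi>"
    have "Re (\<psi> x) \<le> Re (\<phi> x)"
      using state_norm_le[OF \<psi>, of x] complex_Re_le_cmod[of "\<psi> x"] by (simp add: \<phi>(2))
    then show "Re (\<psi> a) \<le> Re (\<phi> a)" by (simp add: val \<psi> \<phi>(1))
  qed (rule \<phi>)
qed

lemma cmod_state_trace_le:
  assumes "state \<phi>"
  shows "cmod (\<phi> (mtrace A)) \<le> real CARD('n) * operator_norm (A :: ('a, 'n::finite) sqmat)"
proof -
  have pf: "positive_functional \<phi>" using assms by (simp add: state_iff)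
  have "cmod (\<phi> (mtrace A)) \<le> (\<Sum>i\<in>(UNIV :: 'n set). operator_norm A)"
    unfolding mtrace_def pf_sum[OF pf]
    by (rule sum_norm_le) (rule order_trans[OF state_norm_le[OF assms] norm_entry_le])
  then show ?thesis by simp
qed

text \<open>The matrix size enters the growth bound only as a constant factor, which
  \<open>pf_power_ratio_le\<close> discards.\<close>

lemma state_trace_power_step:
  fixes H :: "('a, 'n::finite) sqmat"
  assumes st: "state \<phi>" and H: "positive_elt H"
  shows "Re (\<phi> (mtrace (H ^ Suc k))) \<le> operator_norm H * Re (\<phi> (mtrace (H ^ k)))"
proof (rule pf_power_ratio_le[OF pf_trace H])
  show "positive_functional \<phi>" using st by (simp add: state_iff)
  show "cmod (\<phi> (mtrace (H ^ k))) \<le> real CARD('n) * operator_norm H ^ k" for k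
    by (rule order_trans[OF cmod_state_trace_le[OF st]]) (simp add: mult_left_mono operator_norm_power)
qed (rule operator_norm_nonneg)

text \<open>An even power has the form \<open>star C * C\<close> with C = \<open>H ^ l\<close>, so
  its trace dominates \<open>star b * b\<close> for each entry b of C under a state. For the largest
  entry, the norm of C is at most n^2 times that of b; squaring gives n^4. The entry lies in the
  domain, hence \<open>star b * b\<close> has a norming state.\<close>

lemma state_trace_even_power_ge:
  fixes H :: "('a, 'n::finite) sqmat"
  assumes HD: "H \<in> matrices_over D" and H: "star H = H"
  obtains \<psi> where "state \<psi>"
    "operator_norm H ^ (2 * l) \<le> real CARD('n) ^ 4 * Re (\<psi> (mtrace (H ^ (2 * l))))"
proof -
  interpret M: partial_derivation operator_norm "matrices_over D :: ('a, 'n) sqmat set" "entrywise \<delta>"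
    by standard (rule star_derivation_entrywise)
  define C where "C = H ^ l"
  define e where "e p = norm (mat_of C $ fst p $ snd p)" for p :: "'n \<times> 'n"
  have "Max (range e) \<in> range e" by (rule Max_in) auto
  then obtain p where "e p = Max (range e)" by (metis imageE)
  then have max: "e r \<le> e p" for r
    using Max_ge[of "range e" "e r"] by simp
  obtain i j where p: "p = (i, j)" by (cases p)
  define b where "b = mat_of C $ i $ j"
  have "b \<in> D" using M.D_power[OF HD, of l] by (simp add: b_def C_def matrices_over_def)
  then have "star b * b \<in> D" by (simp add: D_mult D_star)
  moreover have "positive_elt (star b * b)" by (auto simp: positive_elt_def)
  ultimately obtain \<psi> where \<psi>: "state \<psi>" "\<psi> (star b * b) = of_real (norm (star b * b))"
    using norming_state by blast
  have pf: "positive_functional \<psi>" using \<psi>(1) by (simp add: state_iff)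
  have "operator_norm H ^ l \<le> operator_norm C"
    unfolding C_def by (rule operator_norm_power_ge[OF H])
  also have "\<dots> \<le> (\<Sum>i\<in>(UNIV :: 'n set). \<Sum>j\<in>(UNIV :: 'n set). norm b)"
    by (rule order_trans[OF operator_norm_le_entries])
      (intro sum_mono, use max[of "(_, _)"] in \<open>simp add: e_def p b_def\<close>)
  finally have "operator_norm H ^ l \<le> real CARD('n) ^ 2 * norm b"
    by (simp add: power2_eq_square)
  then have "(operator_norm H ^ l)\<^sup>2 \<le> (real CARD('n) ^ 2 * norm b)\<^sup>2"
    by (rule power_mono) (simp add: operator_norm_nonneg)
  then have "operator_norm H ^ (2 * l) \<le> real CARD('n) ^ 4 * (norm b)\<^sup>2"
    by (simp add: power_mult_distrib power_mult[symmetric] mult.commute)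
  also have "(norm b)\<^sup>2 \<le> Re (\<psi> (mtrace (H ^ (2 * l))))"
  proof -
    let ?f = "\<lambda>i j. Re (\<psi> (star (mat_of C $ i $ j) * mat_of C $ i $ j))"
    have "(norm b)\<^sup>2 = ?f i j" using \<psi>(2) by (simp add: b_def cstar_identity)
    also have "\<dots> \<le> (\<Sum>i\<in>UNIV. ?f i j)"
      by (rule member_le_sum) (auto simp: pf_square_nonneg[OF pf])
    also have "\<dots> \<le> (\<Sum>j\<in>UNIV. \<Sum>i\<in>UNIV. ?f i j)"
      by (rule member_le_sum) (auto simp: pf_square_nonneg[OF pf] intro: sum_nonneg)
    also have "\<dots> = Re (\<psi> (mtrace (star C * C)))"
      by (simp add: mtrace_def mat_of_mult pf_sum[OF pf])
    also have "star C * C = H ^ (2 * l)"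
      by (simp add: C_def star_power H power_add[symmetric] mult_2)
    finally show ?thesis .
  qed
  finally show ?thesis using that \<psi>(1) by (simp add: mult_left_mono)
qed

section \<open>Construction of the approximating states\<close>

lemma operator_norm_entrywise_power:
  fixes H :: "('a, 'n::finite) sqmat"
  assumes HD: "H \<in> matrices_over D"
  shows "operator_norm (entrywise \<delta> (H ^ Suc k))
    \<le> real (Suc k) * operator_norm H ^ k * operator_norm (entrywise \<delta> H)"
proof (induction k)
  case (Suc k)
  interpret M: partial_derivation operator_norm "matrices_over D :: ('a, 'n) sqmat set" "entrywise \<delta>"
    by standard (rule star_derivation_entrywise)
  let ?q = "operator_norm H" and ?d = "operator_norm (entrywise \<delta> H)"
  have "entrywise \<delta> (H ^ Suc (Suc k)) = entrywise \<delta> H * H ^ Suc k + H * entrywise \<delta> (H ^ Suc k)"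
    by (subst power_Suc) (rule M.\<delta>_mult[OF HD M.D_power[OF HD]])
  then have "operator_norm (entrywise \<delta> (H ^ Suc (Suc k)))
      \<le> operator_norm (entrywise \<delta> H * H ^ Suc k) + operator_norm (H * entrywise \<delta> (H ^ Suc k))"
    by (simp only: operator_norm_add)
  also have "\<dots> \<le> ?d * ?q ^ Suc k + ?q * (real (Suc k) * ?q ^ k * ?d)"
    by (intro add_mono order_trans[OF operator_norm_mult] mult_left_mono operator_norm_power
        operator_norm_nonneg Suc)
  also have "\<dots> = real (Suc (Suc k)) * ?q ^ Suc k * ?d"
    by (simp add: algebra_simps)
  finally show ?case .
qed simp


text \<open>Removes the constant \<open>C\<close>: on positive matrices by the growth of powers, in
  general by Cauchy-Schwarz against 1. The resulting bounds are the same for all functionals, as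
  compactness requires, and the one on positive matrices is sharp, as a norming limit
  requires.\<close>

lemma state_bounded_if_some_bound:
  fixes \<Phi> :: "('a, 'n::finite) sqmat \<Rightarrow> complex"
  assumes st: "state \<Phi>" and bound: "\<And>X. cmod (\<Phi> X) \<le> C * operator_norm X" and C: "0 \<le> C"
  shows "cmod (\<Phi> X) \<le> sqrt (operator_norm (star X * X))"
    and "positive_elt Z \<Longrightarrow> Re (\<Phi> Z) \<le> operator_norm Z"
proof -
  have pf: "positive_functional \<Phi>" and one: "\<Phi> 1 = 1" using st by (auto simp: state_iff)
  show pos: "Re (\<Phi> Z) \<le> operator_norm Z" if Z: "positive_elt Z" for Z
  proof -
    have "Re (\<Phi> (Z ^ Suc 0)) \<le> operator_norm Z * Re (\<Phi> (Z ^ 0))"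
    proof (rule pf_power_ratio_le[OF pf Z])
      show "cmod (\<Phi> (Z ^ k)) \<le> C * operator_norm Z ^ k" for k
        by (rule order_trans[OF bound]) (intro mult_left_mono operator_norm_power C)
    qed (rule operator_norm_nonneg)
    then show ?thesis by (simp add: one)
  qed
  have "(cmod (\<Phi> X))\<^sup>2 \<le> Re (\<Phi> (star X * X))"
    using pf_cauchy_schwarz[OF pf, of 1 X] by (simp add: one)
  also have "\<dots> \<le> operator_norm (star X * X)"
    by (rule pos) (auto simp: positive_elt_def)
  finally show "cmod (\<Phi> X) \<le> sqrt (operator_norm (star X * X))"
    by (rule real_le_rsqrt)
qed

text \<open>The truncation error is geometric in the degree with polynomial factors, while the
  deficit of \<open>\<Phi> H\<close> is controlled by the geometric sum. Hence for fixed norm of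
  \<open>H\<close> the degree can be made large first, before that norm tends to 1.\<close>

lemma almost_norming_state:
  fixes H :: "('a, 'n::finite) sqmat" and l :: nat
  assumes HD: "H \<in> matrices_over D" and pos: "positive_elt H"
    and q: "0 < operator_norm H" "operator_norm H < 1"
  obtains \<Phi> where "state \<Phi>" "\<And>X. cmod (\<Phi> X) \<le> sqrt (operator_norm (star X * X))"
    "\<And>Z. positive_elt Z \<Longrightarrow> Re (\<Phi> Z) \<le> operator_norm Z"
    "1 - real CARD('n) ^ 5 / (\<Sum>k\<le>2 * l. operator_norm H ^ k) \<le> Re (\<Phi> H)"
    "cmod (\<Phi> (entrywise \<delta> H))
      \<le> 2 * real CARD('n) * (real (2 * l) + 1)\<^sup>2 * operator_norm H ^ (2 * l) * operator_norm (entrywise \<delta> H)"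
proof -
  interpret M: partial_derivation operator_norm "matrices_over D :: ('a, 'n) sqmat set" "entrywise \<delta>"
    by standard (rule star_derivation_entrywise)
  define n where "n = real CARD('n)"
  define q where "q = operator_norm H"
  define d where "d = operator_norm (entrywise \<delta> H)"
  \<comment> \<open>Even, so that \<open>state_trace_even_power_ge\<close> applies to the top power
    in \<open>R\<close>.\<close>
  define m where "m = 2 * l"
  define R where "R = (\<Sum>k\<le>m. H ^ k)"
  define E where "E = H ^ Suc m"
  define Y where "Y = entrywise \<delta> R"
  have n1: "n \<ge> 1" by (simp add: n_def Suc_leI)
  have q01: "0 < q" "q < 1" using q by (simp_all add: q_def)
  have d0: "0 \<le> d" by (simp add: d_def operator_norm_nonneg)
  have sH: "star H = H" by (rule positive_elt_selfadjoint[OF pos])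
  have sR: "star R = R" by (simp add: R_def star_sum star_power sH)
  have powD: "H ^ k \<in> matrices_over D" for k by (rule M.D_power[OF HD])
  have RD: "R \<in> matrices_over D" unfolding R_def by (rule M.D_sum) (rule powD)
  have ED: "E \<in> matrices_over D" unfolding E_def by (rule powD)
  have HR: "H * R = R - 1 + E"
    unfolding R_def E_def by (induction m) (simp_all add: distrib_left)
  have RH: "R * H = R - 1 + E"
    unfolding R_def E_def by (induction m) (simp_all add: distrib_right power_commutes mult.assoc)
  have "mtrace R \<in> D" unfolding mtrace_def by (rule D_sum) (use RD in \<open>simp add: matrices_over_def\<close>)
  moreover have "star (mtrace R) = mtrace R"
  proof -
    have "star (mat_of R $ i $ i) = mat_of R $ i $ i" for i
      by (metis mat_of_star sR)
    then show ?thesis by (simp add: mtrace_def star_sum)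
  qed
  ultimately obtain \<phi> where st: "state \<phi>" and \<phi>\<delta>: "\<phi> (\<delta> (mtrace R)) = 0"
    and \<phi>_max: "\<And>\<psi>. state \<psi> \<Longrightarrow> Re (\<psi> (mtrace R)) \<le> Re (\<phi> (mtrace R))"
    using norming_state_selfadjoint by blast
  have pf\<phi>: "positive_functional \<phi>" using st by (simp add: state_iff)
  define \<tau> where "\<tau> = (\<lambda>X :: ('a, 'n) sqmat. \<phi> (mtrace X))"
  have pf: "positive_functional \<tau>" unfolding \<tau>_def by (rule pf_trace[OF pf\<phi>])
  have \<tau>_le: "cmod (\<tau> X) \<le> n * operator_norm X" for X
    unfolding \<tau>_def n_def by (rule cmod_state_trace_le[OF st])
  have \<tau>1: "\<tau> 1 = of_real n"
  proof -
    have "mtrace (1 :: ('a, 'n) sqmat) = (\<Sum>i\<in>(UNIV :: 'n set). 1)"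
      by (simp add: mtrace_def mat_of_one)
    then show ?thesis using st by (simp add: \<tau>_def pf_sum[OF pf\<phi>] state_def n_def del: sum_constant) simp
  qed
  define t where "t = Re (\<tau> R)"
  define s where "s = Re (\<tau> (R * R))"
  have t_sum: "t = (\<Sum>k\<le>m. Re (\<tau> (H ^ k)))"
    by (simp add: t_def R_def pf_sum[OF pf])
  \<comment> \<open>The term k = 0 alone contributes n and the others are nonnegative; this keeps t
    and s at least 1 for the divisions below.\<close>
  have "Re (\<tau> (H ^ 0)) \<le> t"
    unfolding t_sum by (rule member_le_sum) (auto intro: pf_power_nonneg[OF pf pos])
  then have t_n: "n \<le> t" by (simp add: \<tau>1)
  then have t1: "1 \<le> t" using n1 by linarith
  have t2: "t\<^sup>2 \<le> n * s"
  proof -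
    have "t\<^sup>2 \<le> (cmod (\<tau> R))\<^sup>2"
      unfolding t_def using abs_Re_le_cmod by (simp add: abs_le_square_iff[symmetric])
    also have "\<dots> \<le> n * s"
      using pf_cauchy_schwarz[OF pf, of 1 R] by (simp add: \<tau>1 s_def sR)
    finally show ?thesis .
  qed
  have s1: "1 \<le> s"
  proof -
    have "n * n \<le> t\<^sup>2" unfolding power2_eq_square using t_n n1 by (intro mult_mono) auto
    then have "n * n \<le> n * s" using t2 by linarith
    then show ?thesis using n1 by simp
  qed
  have s_eq: "\<tau> (R * R) = of_real s"
    using pf_square_real[OF pf, of R] by (simp add: sR s_def)

  define \<Phi> where "\<Phi> X = complex_of_real (1 / s) * \<tau> (R * X * R)" for X
  have st\<Phi>: "state \<Phi>"
  proof -
    have "positive_functional (\<lambda>X. \<tau> (R * X * R))"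
      using pf_sandwich[OF pf, of R] by (simp add: sR)
    moreover have "complex_of_real (1 / s) \<in> \<real>\<^sub>\<ge>\<^sub>0" using s1 by simp
    ultimately have "positive_functional \<Phi>"
      unfolding \<Phi>_def by (rule pf_scale)
    then show ?thesis using s1 by (simp add: state_iff \<Phi>_def s_eq)
  qed
  have \<Phi>_bound: "cmod (\<Phi> X) \<le> (1 / s * n * (operator_norm R)\<^sup>2) * operator_norm X" for X
  proof -
    have "cmod (\<tau> (R * X * R)) \<le> n * operator_norm (R * X * R)" by (rule \<tau>_le)
    also have "\<dots> \<le> n * ((operator_norm R * operator_norm X) * operator_norm R)"
      using n1
      by (intro mult_left_mono order_trans[OF operator_norm_mult] mult_right_mono operator_norm_mult
          operator_norm_nonneg) simp
    finally show ?thesis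
      using s1 by (simp add: \<Phi>_def norm_mult norm_divide power2_eq_square divide_right_mono mult_ac)
  qed
  have bound_nonneg: "0 \<le> 1 / s * n * (operator_norm R)\<^sup>2" using s1 n1 by simp

  \<comment> \<open>By maximality of \<open>\<phi>\<close> it suffices to bound one state from below; a state norming an entry of \<open>H ^ l\<close>
    is large on the trace of \<open>H ^ (2 * l)\<close>, hence on the traces of all lower powers.\<close>
  have t_ge: "(\<Sum>k\<le>m. q ^ k) \<le> n ^ 4 * t"
  proof -
    obtain \<psi> where \<psi>: "state \<psi>" "q ^ m \<le> n ^ 4 * Re (\<psi> (mtrace (H ^ m)))"
      using state_trace_even_power_ge[OF HD sH] unfolding q_def m_def n_def by blast
    have "q ^ k \<le> n ^ 4 * Re (\<psi> (mtrace (H ^ k)))" if "k \<le> m" for k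
      using that
    proof (induction k rule: inc_induct)
      case base
      show ?case by (rule \<psi>)
    next
      case (step k)
      have "q * q ^ k \<le> n ^ 4 * Re (\<psi> (mtrace (H ^ Suc k)))" using step by simp
      also have "\<dots> \<le> n ^ 4 * (q * Re (\<psi> (mtrace (H ^ k))))"
        unfolding q_def using n1 by (intro mult_left_mono state_trace_power_step[OF \<psi>(1) pos]) simp
      finally have "q * q ^ k \<le> q * (n ^ 4 * Re (\<psi> (mtrace (H ^ k))))" by (simp add: mult_ac)
      then show ?case using q01 by simp
    qed
    then have "(\<Sum>k\<le>m. q ^ k) \<le> (\<Sum>k\<le>m. n ^ 4 * Re (\<psi> (mtrace (H ^ k))))"
      by (intro sum_mono) simp
    also have "\<dots> = n ^ 4 * Re (\<psi> (mtrace R))"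
    proof -
      have "positive_functional \<psi>" using \<psi>(1) by (simp add: state_iff)
      then show ?thesis by (simp add: R_def mtrace_sum pf_sum sum_distrib_left)
    qed
    also have "\<dots> \<le> n ^ 4 * t"
      unfolding t_def \<tau>_def using n1 by (intro mult_left_mono \<phi>_max \<psi>) simp
    finally show ?thesis .
  qed

  have lower: "1 - n ^ 5 / (\<Sum>k\<le>m. q ^ k) \<le> Re (\<Phi> H)"
  proof -
    have "R * H * R = R * R - R + R * E"
      by (simp add: mult.assoc HR algebra_simps)
    moreover have "0 \<le> Re (\<tau> (R * E))"
    proof -
      have "R * E = (\<Sum>k\<le>m. H ^ (k + Suc m))"
        by (simp only: R_def E_def sum_distrib_right power_add)
      then show ?thesis
        by (simp only: pf_sum[OF pf] Re_sum) (intro sum_nonneg pf_power_nonneg[OF pf pos])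
    qed
    ultimately have "s - t \<le> Re (\<tau> (R * H * R))"
      by (simp add: pf_add[OF pf] pf_diff[OF pf] s_def t_def)
    then have "(s - t) / s \<le> Re (\<Phi> H)"
      using s1 by (simp add: \<Phi>_def divide_right_mono)
    moreover have "t / s \<le> n ^ 5 / (\<Sum>k\<le>m. q ^ k)"
    proof -
      have S: "(\<Sum>k\<le>m. q ^ k) > 0"
        using q01 by (intro sum_pos) auto
      have "t * (\<Sum>k\<le>m. q ^ k) \<le> t * (n ^ 4 * t)"
        using t1 by (intro mult_left_mono t_ge) simp
      also have "\<dots> = n ^ 4 * t\<^sup>2" by (simp add: power2_eq_square)
      also have "\<dots> \<le> n ^ 4 * (n * s)" using n1 by (intro mult_left_mono t2) simp
      also have "\<dots> = n ^ 5 * s" by (simp add: power_numeral_reduce)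
      finally show ?thesis using S s1 by (simp add: field_simps)
    qed
    ultimately show ?thesis using s1 by (simp add: diff_divide_distrib)
  qed

  have small: "cmod (\<Phi> (entrywise \<delta> H)) \<le> 2 * n * (real m + 1)\<^sup>2 * q ^ m * d"
  proof -
    have "\<tau> Y = 0"
    proof -
      have "mtrace Y = \<delta> (mtrace R)"
        unfolding mtrace_def Y_def using RD by (subst \<delta>_sum) (simp_all add: matrices_over_def)
      then show ?thesis by (simp add: \<tau>_def \<phi>\<delta>)
    qed
    \<comment> \<open>Differentiating \<open>H * R = R - 1 + E\<close> expresses \<open>R * \<delta> H * R\<close> by \<open>\<delta> R\<close> up to terms containing \<open>E\<close>.\<close>
    have "entrywise \<delta> H * R + H * Y = entrywise \<delta> (H * R)"
      by (simp add: M.\<delta>_mult HD RD Y_def)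
    \<comment> \<open>The summand -1 is written as a scalar multiple because the derivation rules
      are stated for sums and scalars.\<close>
    also have "\<dots> = entrywise \<delta> (R + (scaleC (- 1) 1 + E))"
      by (simp add: HR scaleC_minus_one algebra_simps)
    also have "\<dots> = Y + entrywise \<delta> E"
      by (simp add: M.\<delta>_add M.D_add M.D_scaleC M.\<delta>_scaleC M.\<delta>_one M.D_one RD ED Y_def)
    finally have "entrywise \<delta> H * R = Y + entrywise \<delta> E - H * Y"
      by (simp add: algebra_simps)
    then have "R * entrywise \<delta> H * R = R * Y + R * entrywise \<delta> E - R * H * Y"
      by (simp only: mult.assoc distrib_left right_diff_distrib)
    \<comment> \<open>By \<open>RH\<close> the two terms \<open>R * Y\<close> cancel.
      \<open>\<tau>\<close> annihilates the remaining \<open>Y\<close>, and everything else contains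
      \<open>E\<close> or its derivative.\<close>
    then have RdHR: "R * entrywise \<delta> H * R = Y - E * Y + R * entrywise \<delta> E"
      by (simp add: RH algebra_simps)
    \<comment> \<open>Uniform in k <= m because q < 1; summing m + 1 such bounds produces the square
      of m + 1.\<close>
    have dpow: "operator_norm (entrywise \<delta> (H ^ k)) \<le> real m * d + d" if "k \<le> m" for k
    proof (cases k)
      case 0
      then show ?thesis using d0 operator_norm_scaleC[of 0 "1 :: ('a, 'n) sqmat"] by (simp add: M.\<delta>_one)
    next
      case (Suc j)
      have "operator_norm (entrywise \<delta> (H ^ k)) \<le> real k * q ^ j * d"
        unfolding Suc q_def d_def by (rule operator_norm_entrywise_power[OF HD])
      also have "\<dots> \<le> (real m * 1) * d"
        using that q01 d0 by (intro mult_right_mono mult_mono power_le_one) auto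
      finally show ?thesis using d0 by simp
    qed
    have NY: "operator_norm Y \<le> (real m + 1)\<^sup>2 * d"
    proof -
      have "Y = (\<Sum>k\<le>m. entrywise \<delta> (H ^ k))"
        unfolding Y_def R_def by (rule M.\<delta>_sum) (rule powD)
      then have "operator_norm Y \<le> (\<Sum>k\<le>m. operator_norm (entrywise \<delta> (H ^ k)))"
        by (simp add: operator_norm_sum)
      also have "\<dots> \<le> (\<Sum>k\<le>m. real m * d + d)"
        by (intro sum_mono dpow) simp
      also have "\<dots> = (real m + 1)\<^sup>2 * d" by (simp add: power2_eq_square algebra_simps)
      finally show ?thesis .
    qed
    have Hk: "operator_norm (H ^ k) \<le> q ^ k" for k
      unfolding q_def by (rule operator_norm_power)
    have NR: "operator_norm R \<le> real m + 1"
    proof -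
      have "operator_norm R \<le> (\<Sum>k\<le>m. operator_norm (H ^ k))"
        unfolding R_def by (rule operator_norm_sum)
      also have "\<dots> \<le> (\<Sum>k\<le>m. 1)"
        using q01 by (intro sum_mono order_trans[OF Hk] power_le_one) auto
      finally show ?thesis by simp
    qed
    have NE: "operator_norm E \<le> q ^ m"
    proof -
      have "operator_norm E \<le> q ^ Suc m" unfolding E_def by (rule Hk)
      also have "\<dots> \<le> q ^ m" using q01 by (intro power_decreasing) auto
      finally show ?thesis .
    qed
    have NdE: "operator_norm (entrywise \<delta> E) \<le> (real m + 1) * q ^ m * d"
      using operator_norm_entrywise_power[OF HD, of m] by (simp add: E_def q_def d_def algebra_simps)
    have "operator_norm (E * Y) \<le> q ^ m * ((real m + 1)\<^sup>2 * d)"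
      using q01
      by (intro order_trans[OF operator_norm_mult] mult_mono NE NY operator_norm_nonneg) simp
    moreover have "operator_norm (R * entrywise \<delta> E) \<le> (real m + 1) * ((real m + 1) * q ^ m * d)"
      by (intro order_trans[OF operator_norm_mult] mult_mono NR NdE operator_norm_nonneg) simp
    moreover have "(real m + 1) * ((real m + 1) * q ^ m * d) = q ^ m * ((real m + 1)\<^sup>2 * d)"
      by (simp add: power2_eq_square)
    \<comment> \<open>Both error terms have the same bound, whence the factor 2.\<close>
    ultimately have le: "operator_norm (E * Y) + operator_norm (R * entrywise \<delta> E)
        \<le> 2 * (q ^ m * ((real m + 1)\<^sup>2 * d))"
      by linarith
    have "cmod (\<tau> (R * entrywise \<delta> H * R)) = cmod (\<tau> (R * entrywise \<delta> E) - \<tau> (E * Y))"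
      by (simp add: RdHR pf_add[OF pf] pf_diff[OF pf] \<open>\<tau> Y = 0\<close>)
    also have "\<dots> \<le> n * operator_norm (R * entrywise \<delta> E) + n * operator_norm (E * Y)"
      by (rule order_trans[OF norm_triangle_ineq4]) (intro add_mono \<tau>_le)
    also have "\<dots> = n * (operator_norm (E * Y) + operator_norm (R * entrywise \<delta> E))"
      by (simp add: algebra_simps)
    also have "\<dots> \<le> n * (2 * (q ^ m * ((real m + 1)\<^sup>2 * d)))"
      using n1 by (intro mult_left_mono le) simp
    finally have *: "cmod (\<tau> (R * entrywise \<delta> H * R)) \<le> 2 * n * (real m + 1)\<^sup>2 * q ^ m * d"
      by (simp add: mult_ac)
    have "cmod (\<Phi> (entrywise \<delta> H)) = cmod (\<tau> (R * entrywise \<delta> H * R)) / s"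
      using s1 by (simp add: \<Phi>_def norm_mult norm_divide)
    also have "\<dots> \<le> cmod (\<tau> (R * entrywise \<delta> H * R)) / 1"
      using s1 by (intro divide_left_mono) auto
    finally show ?thesis using * by simp
  qed
  show ?thesis
    by (rule that[OF st\<Phi> state_bounded_if_some_bound[OF st\<Phi> \<Phi>_bound bound_nonneg]
          lower[unfolded n_def m_def q_def] small[unfolded n_def m_def q_def d_def]])
qed


section \<open>Rescaling and passage to the limit\<close>

lemma approximate_state:
  fixes A :: "('a, 'n::finite) sqmat"
  assumes AD: "A \<in> matrices_over D" and pos: "positive_elt A" and N: "0 < operator_norm A"
    and q: "0 < q" "q < 1" and \<eta>: "0 < \<eta>"
  obtains \<Phi> where "state \<Phi>" "\<And>X. cmod (\<Phi> X) \<le> sqrt (operator_norm (star X * X))"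
    "Re (\<Phi> A) \<le> operator_norm A"
    "operator_norm A * (1 - 2 * real CARD('n) ^ 5 * (1 - q)) \<le> Re (\<Phi> A)"
    "cmod (\<Phi> (entrywise \<delta> A)) \<le> \<eta>"
proof -
  interpret M: partial_derivation operator_norm "matrices_over D :: ('a, 'n) sqmat set" "entrywise \<delta>"
    by standard (rule star_derivation_entrywise)
  define n where "n = real CARD('n)"
  define N where "N = operator_norm A"
  have N0: "0 < N" using N by (simp add: N_def)
  have n0: "0 < n" by (simp add: n_def)
  define H where "H = scaleC (of_real (q / N)) A"
  have NH: "operator_norm H = q"
    using q N0 by (simp add: H_def operator_norm_scaleC N_def[symmetric] norm_divide)
  have HD: "H \<in> matrices_over D" by (simp add: H_def M.D_scaleC AD)
  have Hpos: "positive_elt H"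
    unfolding H_def using q N0 by (intro positive_elt_scaleC pos) simp
  have \<delta>H: "entrywise \<delta> H = scaleC (of_real (q / N)) (entrywise \<delta> A)"
    unfolding H_def by (rule M.\<delta>_scaleC[OF AD])
  define d where "d = operator_norm (entrywise \<delta> H)"
  have "(\<lambda>m. 2 * n * ((real m + 1)\<^sup>2 * q ^ m) * d) \<longlonglongrightarrow> 2 * n * 0 * d"
    by (intro tendsto_intros square_times_power_tendsto_zero q)
  then have "\<forall>\<^sub>F m in sequentially. 2 * n * ((real m + 1)\<^sup>2 * q ^ m) * d < \<eta> * q / N"
    using \<eta> q N0 by (intro order_tendstoD(2)) auto
  moreover have "\<forall>\<^sub>F m in sequentially. q ^ m < 1 / 2"
    using q by (intro order_tendstoD(2)[OF LIMSEQ_realpow_zero]) auto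
  \<comment> \<open>The tolerance is \<open>\<eta> * q / N\<close> because \<open>H\<close> is q/N
    times \<open>A\<close>. The choice must work for all m >= l: it is used at m = 2l for the
    derivative and at m = 2l + 1 for the geometric sum.\<close>
  ultimately obtain l where l: "\<And>m. m \<ge> l \<Longrightarrow>
      2 * n * ((real m + 1)\<^sup>2 * q ^ m) * d < \<eta> * q / N \<and> q ^ m < 1 / 2"
    using eventually_conj unfolding eventually_sequentially
    by (metis (no_types, lifting) linorder_linear order_trans)
  obtain \<Phi> where st: "state \<Phi>" and bound: "\<And>X. cmod (\<Phi> X) \<le> sqrt (operator_norm (star X * X))"
    and upper: "\<And>Z. positive_elt Z \<Longrightarrow> Re (\<Phi> Z) \<le> operator_norm Z"
    and low: "1 - n ^ 5 / (\<Sum>k\<le>2 * l. q ^ k) \<le> Re (\<Phi> H)"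
    and small: "cmod (\<Phi> (entrywise \<delta> H)) \<le> 2 * n * (real (2 * l) + 1)\<^sup>2 * q ^ (2 * l) * d"
    using almost_norming_state[OF HD Hpos, of l] q unfolding NH n_def d_def by blast
  have scale: "\<Phi> (scaleC c X) = c * \<Phi> X" for c X using st by (simp add: state_def)
  show ?thesis
  proof
    show "Re (\<Phi> A) \<le> operator_norm A" by (rule upper[OF pos])
    have S: "(\<Sum>k\<le>2 * l. q ^ k) > 0" using q by (intro sum_pos) auto
    \<comment> \<open>(1 - q) times the sum equals 1 - q^(2l+1), here at least 1/2; this is the
      origin of the factor 2 in the lower bound.\<close>
    have "q ^ Suc (2 * l) < 1 / 2" using l[of "Suc (2 * l)"] by simp
    then have "1 / 2 \<le> (1 - q) * (\<Sum>k\<le>2 * l. q ^ k)" by (subst sum_gp_basic) simp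
    then have "1 / (\<Sum>k\<le>2 * l. q ^ k) \<le> 2 * (1 - q)" using S by (simp add: field_simps)
    from mult_left_mono[OF this, of "n ^ 5"]
    have "n ^ 5 / (\<Sum>k\<le>2 * l. q ^ k) \<le> 2 * n ^ 5 * (1 - q)" using n0 by (simp add: algebra_simps)
    with low have "1 - 2 * n ^ 5 * (1 - q) \<le> Re (\<Phi> H)" by linarith
    also have "\<dots> = q / N * Re (\<Phi> A)" by (simp add: H_def scale)
    also have "\<dots> \<le> 1 / N * Re (\<Phi> A)"
    proof -
      have "0 \<le> Re (\<Phi> A)" using pf_positive(2)[OF _ pos] st by (simp add: state_iff)
      then show ?thesis using q N0 by (intro mult_right_mono divide_right_mono) auto
    qed
    finally show "operator_norm A * (1 - 2 * real CARD('n) ^ 5 * (1 - q)) \<le> Re (\<Phi> A)"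
      using N0 by (simp add: N_def[symmetric] n_def[symmetric] field_simps)
    have "q / N * cmod (\<Phi> (entrywise \<delta> A)) = cmod (\<Phi> (entrywise \<delta> H))"
      using q N0 by (simp add: \<delta>H scale norm_mult norm_divide)
    also have "\<dots> \<le> \<eta> * q / N" using small l[of "2 * l"] by (simp add: mult_ac)
    finally show "cmod (\<Phi> (entrywise \<delta> A)) \<le> \<eta>"
      using q N0 by (simp add: field_simps)
  qed (fact st bound)+
qed

lemma well_behaved_entrywise:
  "well_behaved operator_norm (matrices_over D :: ('a, 'n::finite) sqmat set) (entrywise \<delta>)"
  unfolding well_behaved_def
proof (intro ballI impI)
  fix A :: "('a, 'n) sqmat"
  assume AD: "A \<in> matrices_over D" and pos: "positive_elt A"
  define N where "N = operator_norm A"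
  define n where "n = real CARD('n)"
  show "\<exists>\<Phi>. state \<Phi> \<and> \<Phi> A = complex_of_real (operator_norm A) \<and> \<Phi> (entrywise \<delta> A) = 0"
  proof (cases "N = 0")
    case True
    then have "mat_of A $ i $ j = 0" for i j
      using norm_entry_le[of A i j] by (simp add: N_def)
    then have "A = 0" by (intro sqmat_eqI) simp
    moreover have "entrywise \<delta> 0 = (0 :: ('a, 'n) sqmat)"
      by (rule sqmat_eqI) (simp add: \<delta>_zero)
    \<comment> \<open>For the zero matrix any state will do: a norming state of 1, read at an
      arbitrary diagonal position.\<close>
    moreover have "positive_elt (1 :: 'a)" unfolding positive_elt_def by (rule exI[of _ 1]) simp
    then obtain \<phi> :: "'a \<Rightarrow> complex" where "state \<phi>" using norming_state[OF D_one] by blast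
    then have "state (\<lambda>X :: ('a, 'n) sqmat. \<phi> (mat_of X $ undefined $ undefined))"
      using pf_diagonal_entry[of \<phi> undefined] by (simp add: state_iff mat_of_one)
    moreover have "\<phi> 0 = 0" using \<open>state \<phi>\<close> pf_zero[of \<phi>] by (simp only: state_iff)
    ultimately show ?thesis
      using True by (intro exI[of _ "\<lambda>X. \<phi> (mat_of X $ undefined $ undefined)"]) (simp add: N_def)
  next
    case False
    then have N0: "0 < operator_norm A" using operator_norm_nonneg[of A] by (simp add: N_def)
    \<comment> \<open>The double successor makes q 0 = 1/2; with a single one q 0 would be
      0.\<close>
    define q where "q j = 1 - inverse (real (Suc (Suc j)))" for j
    have q: "0 < q j" "q j < 1" for j by (simp_all add: q_def field_simps)
    have "\<exists>\<Phi>. state \<Phi> \<and> (\<forall>X. cmod (\<Phi> X) \<le> sqrt (operator_norm (star X * X)))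
        \<and> Re (\<Phi> A) \<le> N \<and> N * (1 - 2 * n ^ 5 * (1 - q j)) \<le> Re (\<Phi> A)
        \<and> cmod (\<Phi> (entrywise \<delta> A)) \<le> inverse (real (Suc j))" for j
      by (rule approximate_state[OF AD pos N0 q[of j], of "inverse (real (Suc j))"])
        (auto simp: N_def n_def)
    then obtain \<Phi> where st: "\<And>j. state (\<Phi> j)"
      and bound: "\<And>j X. cmod (\<Phi> j X) \<le> sqrt (operator_norm (star X * X))"
      and upper: "\<And>j. Re (\<Phi> j A) \<le> N"
      and lower: "\<And>j. N * (1 - 2 * n ^ 5 * (1 - q j)) \<le> Re (\<Phi> j A)"
      and small: "\<And>j. cmod (\<Phi> j (entrywise \<delta> A)) \<le> inverse (real (Suc j))"
      by metis
    obtain \<Psi> where \<Psi>: "state \<Psi>" and lim: "\<And>X L. (\<lambda>j. \<Phi> j X) \<longlonglongrightarrow> L \<Longrightarrow> \<Psi> X = L"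
      using bounded_states_limit_point[of \<Phi>, OF st bound] by blast
    have "(\<lambda>j. 1 - q j) \<longlonglongrightarrow> 0"
      using LIMSEQ_Suc[OF LIMSEQ_inverse_real_of_nat] by (simp add: q_def)
    then have "(\<lambda>j. N * (1 - 2 * n ^ 5 * (1 - q j))) \<longlonglongrightarrow> N * (1 - 2 * n ^ 5 * 0)"
      by (rule tendsto_mult_left[OF tendsto_diff[OF tendsto_const tendsto_mult_left]])
    then have "(\<lambda>j. N * (1 - 2 * n ^ 5 * (1 - q j))) \<longlonglongrightarrow> N"
      by (simp only: mult_zero_right diff_zero mult_1_right)
    then have "(\<lambda>j. Re (\<Phi> j A)) \<longlonglongrightarrow> N"
      by (rule tendsto_sandwich[OF always_eventually[OF allI[OF lower]] always_eventually[OF allI[OF upper]] _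
            tendsto_const])
    \<comment> \<open>Positivity makes the values real, so convergence of the real parts
      suffices.\<close>
    moreover have "\<Phi> j A = of_real (Re (\<Phi> j A))" for j
      using pf_positive(1)[OF _ pos] st[of j] by (simp add: state_iff)
    ultimately have "(\<lambda>j. \<Phi> j A) \<longlonglongrightarrow> of_real N"
      using tendsto_of_real[of "\<lambda>j. Re (\<Phi> j A)" N sequentially, where ?'a = complex] by simp
    moreover have "(\<lambda>j. \<Phi> j (entrywise \<delta> A)) \<longlonglongrightarrow> 0"
      by (rule Lim_null_comparison[OF always_eventually[OF allI[OF small]] LIMSEQ_inverse_real_of_nat])
    ultimately show ?thesis
      using \<Psi> lim by (auto simp: N_def)
  qed
qed

end

theorem theoremX4:
  fixes D :: "'a::unital_cstar_algebra set" and \<delta> :: "'a \<Rightarrow> 'a"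
  assumes "star_derivation norm D \<delta>"
    and "well_behaved norm D \<delta>"
  shows "star_derivation operator_norm (matrices_over D :: ('a, 'n::finite) sqmat set) (entrywise \<delta>) \<and>
    well_behaved operator_norm (matrices_over D :: ('a, 'n) sqmat set) (entrywise \<delta>)"
proof -
  interpret well_behaved_derivation D \<delta>
    using assms by unfold_locales
  show ?thesis
    by (intro conjI star_derivation_entrywise well_behaved_entrywise)
qed

end
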